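(* Let $A$ be a finite totally ordered alphabet and let $\alpha$ and $\beta$ be $\omega$-terms over $A$ that are both in canonical form. If every finite aperiodic semigroup satisfies $\alpha=\beta$, then $\alpha=\beta$ as terms.
   Context: **Terms.** Let $A$ be a finite alphabet with a fixed total order. A $\bar\kappa$-term over $A$ is a formal expression built from the letters of $A$ using binary concatenation and the unary operations $x\mapsto x^{\omega+q}$, one for each $q\in\mathbb{Z}$; terms differing only in the order in which concatenations are carried out are identified. An $\omega$-term is a $\bar\kappa$-term in which only the power $x^\omega=x^{\omega+0}$ is used. A term is identified with a nonempty well-parenthesized word over the alphabet $A_{\mathbb Z}=A\uplus\{(_q,\ )_q : q\in\mathbb{Z}\}$ having no factor $(_q\,)_q$, by writing each subterm $(\delta)^{\omega+q}$ as $(_q\,\delta\,)_q$. For convenience the empty term (empty word) is also allowed as an auxiliary object (identities are between nonempty terms). Equality, prefix, suffix are understood for the corresponding words over $A_{\mathbb Z}$. The rank of a term is the maximum number of nested pairs of parentheses in it. Every term $\alpha$ of rank $i+1$ factorizes uniquely as $\alpha=\gamma_0\delta_1^{\omega+q_1}\gamma_1\cdots\delta_n^{\omega+q_n}\gamma_n$ with $n\ge 1$, $q_k\in\mathbb Z$, $\mathrm{rank}(\gamma_j)\le i$ and $\mathrm{rank}(\delta_k)=i$. **Lyndon terms.** A term is primitive if it is not of the form $\alpha^n$ with $\alpha$ a term and $n>1$. Terms $\alpha,\beta$ are conjugate if $\alpha=\gamma_1\gamma_2$ and $\beta=\gamma_2\gamma_1$ for some (possibly empty) terms $\gamma_1,\gamma_2$.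 The order on $A$ is extended to $A_{\mathbb Z}$ by $(_p\,<\,(_q\,<\,x\,<\,)_q\,<\,)_p$ for all $x\in A$ and $p<q$ in $\mathbb Z$. A Lyndon term is a primitive term that is minimal in its conjugacy class for the lexicographic order. **Canonical forms.** Rank 0 canonical forms are the words of $A^*$. Recursively, a rank $i+1$ canonical form is a term $\alpha$ of rank $i+1$ whose unique factorization $\alpha=\gamma_0\delta_1^{\omega+q_1}\gamma_1\cdots\delta_n^{\omega+q_n}\gamma_n$ with $n\ge 1$, $q_k\in\mathbb Z$, $\mathrm{rank}(\gamma_j)\le i$ and $\mathrm{rank}(\delta_k)=i$ satisfies: (cf.1) the term $\gamma_0\delta_1^2\gamma_1\cdots\delta_n^2\gamma_n$ is a rank $i$ canonical form; (cf.2) each $\delta_k$ is a Lyndon term of rank $i$; (cf.3) no $\delta_k$ is a suffix of $\gamma_{k-1}$; (cf.4) no $\delta_k$ is a prefix of a term $\gamma_k\delta_{k+1}^{\ell}$ with $\ell\ge 0$ (for $k=n$: $\delta_n$ is not a prefix of $\gamma_n$). **Interpretation.** On a finite semigroup $S$, concatenation is interpreted as multiplication and $s^\omega$ is the unique idempotent power of $s$. $S$ satisfies $\alpha=\beta$ if $\alpha$ and $\beta$ take the same value in $S$ under every map $A\to S$. A finite semigroup is aperiodic if all its subgroups are trivial. *)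

theory Defs
  imports Main "HOL-Library.Sublist" "HOL-Algebra.Group"
begin

section \<open>Terms\<close>

text \<open>
  A term is the list of its top-level factors, so that associativity of concatenation is built in;
  \<open>Pow \<delta> q\<close> stands for \<open>\<delta>\<^sup>\<omega>\<^sup>+\<^sup>q\<close>.  The empty list is the auxiliary empty term.
\<close>

datatype 'a factor = Letter 'a | Pow "'a factor list" int

type_synonym 'a kterm = "'a factor list"

primrec wf_factor :: "'a factor \<Rightarrow> bool" where
  "wf_factor (Letter a) \<longleftrightarrow> True"
| "wf_factor (Pow t q) \<longleftrightarrow> t \<noteq> [] \<and> list_all id (map wf_factor t)"

text \<open>Possibly empty terms: no power, at any depth, is taken of the empty term.\<close>

definition wf_kterm :: "'a kterm \<Rightarrow> bool" where
  "wf_kterm t \<longleftrightarrow> (\<forall>x\<in>set t. wf_factor x)"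

primrec omega_factor :: "'a factor \<Rightarrow> bool" where
  "omega_factor (Letter a) \<longleftrightarrow> True"
| "omega_factor (Pow t q) \<longleftrightarrow> q = 0 \<and> list_all id (map omega_factor t)"

definition omega_term :: "'a kterm \<Rightarrow> bool" where
  "omega_term t \<longleftrightarrow> t \<noteq> [] \<and> wf_kterm t \<and> (\<forall>x\<in>set t. omega_factor x)"

primrec rank_factor :: "'a factor \<Rightarrow> nat" where
  "rank_factor (Letter a) = 0"
| "rank_factor (Pow t q) = Suc (foldr max (map rank_factor t) 0)"

definition rank :: "'a kterm \<Rightarrow> nat" where
  "rank t = foldr max (map rank_factor t) 0"

definition tpow :: "'a kterm \<Rightarrow> nat \<Rightarrow> 'a kterm" where
  "tpow t n = concat (replicate n t)"


section \<open>Terms as well-parenthesized words\<close>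

datatype 'a symb = Opening int | Symb 'a | Closing int

primrec word_factor :: "'a factor \<Rightarrow> 'a symb list" where
  "word_factor (Letter a) = [Symb a]"
| "word_factor (Pow t q) = Opening q # concat (map word_factor t) @ [Closing q]"

definition word :: "'a kterm \<Rightarrow> 'a symb list" where
  "word t = concat (map word_factor t)"

text \<open>Equality of terms is therefore equality of the associated words.\<close>

lemma word_Nil [simp]: "word [] = []"
  by (simp add: word_def)

lemma word_Cons [simp]: "word (x # t) = word_factor x @ word t"
  by (simp add: word_def)

lemma word_factor_Pow: "word_factor (Pow t q) = Opening q # word t @ [Closing q]"
  by (simp add: word_def)

lemma word_Closing_cancel:
  "word t @ Closing p # u = word t' @ Closing p' # u' \<Longrightarrow> t = t' \<and> p = p' \<and> u = u'"
proof (induction "length (word t)" arbitrary: t t' p p' u u' rule: less_induct)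
  case less
  show ?case
  proof (cases t)
    case Nil
    then show ?thesis
      using less.prems by (cases t'; cases "hd t'") (auto simp: word_factor_Pow)
  next
    case t: (Cons x s)
    show ?thesis
    proof (cases t')
      case Nil
      then show ?thesis
        using less.prems t by (cases x) (auto simp: word_factor_Pow)
    next
      case t': (Cons y s')
      show ?thesis
      proof (cases x)
        case x: (Letter a)
        have y: "y = Letter a" and eq: "word s @ Closing p # u = word s' @ Closing p' # u'"
          using less.prems t t' x by (cases y; auto simp: word_factor_Pow)+
        have "s = s' \<and> p = p' \<and> u = u'"
          using less.hyps[OF _ eq] t x by simp
        then show ?thesis
          using t t' x y by simp
      next
        case x: (Pow r q)
        obtain r' where y: "y = Pow r' q" and
          eq: "word r @ Closing q # (word s @ Closing p # u)
             = word r' @ Closing q # (word s' @ Closing p' # u')"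
          using less.prems t t' x by (cases y) (auto simp: word_factor_Pow simp del: word_factor.simps(2))
        have 1: "r = r' \<and> word s @ Closing p # u = word s' @ Closing p' # u'"
          using less.hyps[OF _ eq] t x by (simp add: word_factor_Pow del: word_factor.simps)
        then have "s = s' \<and> p = p' \<and> u = u'"
          using less.hyps[of s p u s' p' u'] t x by (simp add: word_factor_Pow del: word_factor.simps)
        then show ?thesis
          using t t' x y 1 by simp
      qed
    qed
  qed
qed

lemma word_inject: "word t = word t' \<longleftrightarrow> t = t'"
  using word_Closing_cancel[of t 0 "[]" t' 0 "[]"] by auto

fun symb_less :: "'a::linorder symb \<Rightarrow> 'a symb \<Rightarrow> bool" where
  "symb_less (Opening p) (Opening q) \<longleftrightarrow> p < q"
| "symb_less (Opening p) (Symb x) \<longleftrightarrow> True"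
| "symb_less (Opening p) (Closing q) \<longleftrightarrow> True"
| "symb_less (Symb x) (Opening q) \<longleftrightarrow> False"
| "symb_less (Symb x) (Symb y) \<longleftrightarrow> x < y"
| "symb_less (Symb x) (Closing q) \<longleftrightarrow> True"
| "symb_less (Closing p) (Opening q) \<longleftrightarrow> False"
| "symb_less (Closing p) (Symb y) \<longleftrightarrow> False"
| "symb_less (Closing p) (Closing q) \<longleftrightarrow> q < p"

definition term_less :: "'a::linorder kterm \<Rightarrow> 'a kterm \<Rightarrow> bool" where
  "term_less s t \<longleftrightarrow> (word s, word t) \<in> lexord {(x, y). symb_less x y}"

definition term_prefix :: "'a kterm \<Rightarrow> 'a kterm \<Rightarrow> bool" where
  "term_prefix s t \<longleftrightarrow> prefix (word s) (word t)"

definition term_suffix :: "'a kterm \<Rightarrow> 'a kterm \<Rightarrow> bool" where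
  "term_suffix s t \<longleftrightarrow> suffix (word s) (word t)"


section \<open>Lyndon terms and canonical forms\<close>

definition primitive :: "'a kterm \<Rightarrow> bool" where
  "primitive t \<longleftrightarrow> \<not> (\<exists>s n. n > 1 \<and> t = tpow s n)"

definition conjugate :: "'a kterm \<Rightarrow> 'a kterm \<Rightarrow> bool" where
  "conjugate s t \<longleftrightarrow> (\<exists>u v. s = u @ v \<and> t = v @ u)"

definition lyndon :: "'a::linorder kterm \<Rightarrow> bool" where
  "lyndon t \<longleftrightarrow> primitive t \<and> (\<forall>s. conjugate t s \<longrightarrow> \<not> term_less s t)"

text \<open>
  The families are 1-based as in the usual notation: only \<open>\<gamma>\<close> on \<open>{0..n}\<close> and \<open>\<delta>\<close>, \<open>q\<close> on
  \<open>{1..n}\<close> matter, and these are uniquely determined by \<open>i\<close> and \<open>\<alpha>\<close>.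
\<close>

definition factorization ::
    "nat \<Rightarrow> 'a kterm \<Rightarrow> nat \<Rightarrow> (nat \<Rightarrow> 'a kterm) \<Rightarrow> (nat \<Rightarrow> 'a kterm) \<Rightarrow> (nat \<Rightarrow> int) \<Rightarrow> bool" where
  "factorization i \<alpha> n \<gamma> \<delta> q \<longleftrightarrow>
     n \<ge> 1 \<and>
     \<alpha> = \<gamma> 0 @ concat (map (\<lambda>k. Pow (\<delta> k) (q k) # \<gamma> k) [1..<Suc n]) \<and>
     (\<forall>j\<in>{0..n}. rank (\<gamma> j) \<le> i) \<and>
     (\<forall>k\<in>{1..n}. rank (\<delta> k) = i)"

primrec canonical :: "nat \<Rightarrow> 'a::linorder kterm \<Rightarrow> bool" where
  "canonical 0 \<alpha> \<longleftrightarrow> wf_kterm \<alpha> \<and> rank \<alpha> = 0"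
| "canonical (Suc i) \<alpha> \<longleftrightarrow>
     wf_kterm \<alpha> \<and> rank \<alpha> = Suc i \<and>
     (\<exists>n \<gamma> \<delta> q. factorization i \<alpha> n \<gamma> \<delta> q \<and>
        canonical i (\<gamma> 0 @ concat (map (\<lambda>k. tpow (\<delta> k) 2 @ \<gamma> k) [1..<Suc n])) \<and>
        (\<forall>k\<in>{1..n}. lyndon (\<delta> k)) \<and>
        (\<forall>k\<in>{1..n}. \<not> term_suffix (\<delta> k) (\<gamma> (k - 1))) \<and>
        (\<forall>k\<in>{1..<n}. \<forall>l. \<not> term_prefix (\<delta> k) (\<gamma> k @ tpow (\<delta> (Suc k)) l)) \<and>
        \<not> term_prefix (\<delta> n) (\<gamma> n))"

definition canonical_form :: "'a::linorder kterm \<Rightarrow> bool" where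
  "canonical_form \<alpha> \<longleftrightarrow> (\<exists>i. canonical i \<alpha>)"


section \<open>Interpretation in finite semigroups\<close>

text \<open>
  Semigroups are given by a carrier and a multiplication.  Every finite semigroup is isomorphic to
  one on a set of natural numbers, so that carriers of type \<open>nat set\<close> represent all of them.
\<close>

definition finite_semigroup :: "'s set \<Rightarrow> ('s \<Rightarrow> 's \<Rightarrow> 's) \<Rightarrow> bool" where
  "finite_semigroup S m \<longleftrightarrow>
     finite S \<and> (\<forall>x\<in>S. \<forall>y\<in>S. m x y \<in> S) \<and>
     (\<forall>x\<in>S. \<forall>y\<in>S. \<forall>z\<in>S. m (m x y) z = m x (m y z))"

text \<open>A subgroup of a semigroup is a subset that is a group; its identity \<open>e\<close> is any idempotent.\<close>

definition aperiodic :: "'s set \<Rightarrow> ('s \<Rightarrow> 's \<Rightarrow> 's) \<Rightarrow> bool" where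
  "aperiodic S m \<longleftrightarrow>
     (\<forall>G e. G \<subseteq> S \<and> group \<lparr>carrier = G, mult = m, one = e\<rparr> \<longrightarrow> G = {e})"

text \<open>\<open>mult_pow m s n x\<close> is \<open>x s\<^sup>n\<close>, which makes sense for \<open>n = 0\<close> without an identity element.\<close>

definition mult_pow :: "('s \<Rightarrow> 's \<Rightarrow> 's) \<Rightarrow> 's \<Rightarrow> nat \<Rightarrow> 's \<Rightarrow> 's" where
  "mult_pow m s n = ((\<lambda>x. m x s) ^^ n)"

definition powers :: "('s \<Rightarrow> 's \<Rightarrow> 's) \<Rightarrow> 's \<Rightarrow> 's set" where
  "powers m s = {mult_pow m s n s | n. True}"

definition omega :: "('s \<Rightarrow> 's \<Rightarrow> 's) \<Rightarrow> 's \<Rightarrow> 's" where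
  "omega m s = (THE e. e \<in> powers m s \<and> m e e = e)"

text \<open>
  For \<open>q < 0\<close>, \<open>s\<^sup>\<omega>\<^sup>+\<^sup>q\<close> is the inverse of \<open>s\<^sup>\<omega>\<^sup>-\<^sup>q\<close> in the group of all powers \<open>x\<close> of \<open>s\<close> with
  \<open>s\<^sup>\<omega> x = x\<close>.  For omega-terms only \<open>omega_pow m 0 = omega m\<close> matters.
\<close>

definition omega_pow :: "('s \<Rightarrow> 's \<Rightarrow> 's) \<Rightarrow> int \<Rightarrow> 's \<Rightarrow> 's" where
  "omega_pow m q s =
     (if q \<ge> 0 then mult_pow m s (nat q) (omega m s)
      else (THE x. x \<in> powers m s \<and> m (omega m s) x = x \<and> mult_pow m s (nat (- q)) x = omega m s))"

text \<open>Product of a nonempty list; the value on \<open>[]\<close> is irrelevant.\<close>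

definition list_mult :: "('s \<Rightarrow> 's \<Rightarrow> 's) \<Rightarrow> 's list \<Rightarrow> 's" where
  "list_mult m xs = foldl m (hd xs) (tl xs)"

primrec value_factor :: "('s \<Rightarrow> 's \<Rightarrow> 's) \<Rightarrow> ('a \<Rightarrow> 's) \<Rightarrow> 'a factor \<Rightarrow> 's" where
  "value_factor m h (Letter a) = h a"
| "value_factor m h (Pow t q) = omega_pow m q (list_mult m (map (value_factor m h) t))"

definition value_term :: "('s \<Rightarrow> 's \<Rightarrow> 's) \<Rightarrow> ('a \<Rightarrow> 's) \<Rightarrow> 'a kterm \<Rightarrow> 's" where
  "value_term m h t = list_mult m (map (value_factor m h) t)"

definition satisfies :: "'s set \<Rightarrow> ('s \<Rightarrow> 's \<Rightarrow> 's) \<Rightarrow> 'a kterm \<Rightarrow> 'a kterm \<Rightarrow> bool" where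
  "satisfies S m \<alpha> \<beta> \<longleftrightarrow> (\<forall>h. range h \<subseteq> S \<longrightarrow> value_term m h \<alpha> = value_term m h \<beta>)"

end

theory Submission
  imports Defs
begin

text \<open>
  For fixed \<open>k\<close>, the words indistinguishable by \<open>k\<close> rounds of the cutting game (\<open>eqv k\<close> below)
  form finitely many classes, whose quotient is a finite aperiodic monoid.  Hence an identity valid
  in all finite aperiodic semigroups makes the words obtained by replacing every \<open>\<omega>\<close> with a large
  exponent \<open>n\<close> equivalent for every \<open>k\<close>.  The terms are then recovered one rank at a time: if all
  powers of rank above \<open>j\<close> are expanded to exponent \<open>n\<close>, then the places where a power of rank
  \<open>j + 1\<close> was expanded can be recognized with boundedly many further cuts, because long runs of two
  distinct Lyndon terms cannot overlap much and the conditions on canonical forms fix where each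
  run ends.  So equivalence passes from the expansions of level \<open>j\<close> to those of level
  \<open>j + 1\<close>, and at the top level it says that the terms themselves are equal.
\<close>

section \<open>Powers of words\<close>

text \<open>The number of rounds must be fixed before \<open>n\<close> is chosen, so no constant of
  the recognition step may depend on \<open>n\<close>. The constants are read off from the
  expansions with exponent 2: by (cf.1) these are canonical again, so (cf.2)-(cf.4) are available
  there. The conditions pass to exponent \<open>n\<close> because each of them concerns a factor
  with block letters at most at its two ends, and such a factor cannot contain a full copy of an
  expanded base in its interior. The obstacle is that a cut at a boundary between factors must be
  answered at a boundary, although an expanded block has length at least \<open>n\<close> and cannot
  be read in boundedly many rounds. Hence "inside a block" is expressed by a test of bounded reach,
  \<open>Inside_Block\<close>, which is shown to hold exactly for the cuts that are not at
  boundaries. That the terms are omega-terms matters when a block is recovered from its root: the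
  expansion does not show the exponent \<open>q\<close>, and only \<open>q = 0\<close> makes the
  root determine the block.\<close>

abbreviation pw :: "'b list \<Rightarrow> nat \<Rightarrow> 'b list" where
  "pw w n \<equiv> concat (replicate n w)"

lemma pw_add: "pw w (m + n) = pw w m @ pw w n"
  by (simp add: replicate_add)

lemma pw_Suc_right: "pw w (Suc n) = pw w n @ w"
  using pw_add[of n 1 w] by simp

lemma length_pw: "length (pw w n) = n * length w"
  by (induction n) auto

text \<open>The cut falls into one copy \<open>x @ y\<close> of \<open>w\<close>. Since
  \<open>y\<close> is nonempty, a cut between two copies is charged to the right one, with
  \<open>x = []\<close>.\<close>

lemma pw_cut:
  "pw w n = u @ v \<Longrightarrow> v \<noteq> [] \<Longrightarrow>
    \<exists>a b x y. w = x @ y \<and> y \<noteq> [] \<and> u = pw w a @ x \<and> v = y @ pw w b \<and> n = Suc (a + b)"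
proof (induction n arbitrary: u)
  case 0
  then show ?case by simp
next
  case (Suc n)
  show ?case
  proof (cases "length u < length w")
    case True
    then obtain y where "w = u @ y" "y \<noteq> []"
      using Suc.prems(1) by (auto simp: append_eq_append_conv2)
    then show ?thesis
      using Suc.prems(1) by (intro exI[of _ 0] exI[of _ n] exI[of _ u] exI[of _ y]) auto
  next
    case False
    then obtain u' where u': "u = w @ u'" "pw w n = u' @ v"
      using Suc.prems(1) by (auto simp: append_eq_append_conv2)
    obtain a b x y where "w = x @ y" "y \<noteq> []" "u' = pw w a @ x" "v = y @ pw w b" "n = Suc (a + b)"
      using Suc.IH[OF u'(2) Suc.prems(2)] by blast
    then show ?thesis
      using u' by (intro exI[of _ "Suc a"] exI[of _ b] exI[of _ x] exI[of _ y]) auto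
  qed
qed

lemma pw_rotate: "pw (x @ y) n @ x = x @ pw (y @ x) n"
  by (induction n) auto

lemma primitive_nonempty: "primitive t \<Longrightarrow> t \<noteq> []"
  unfolding primitive_def tpow_def
  by (metis concat_replicate_trivial less_numeral_extra(1) one_less_numeral_iff semiring_norm(76))

text \<open>Commuting words are powers of a common word, and a primitive word can only be its first
  power.\<close>

lemma primitive_commute:
  assumes "primitive c" "primitive e" "c @ e = e @ c"
  shows "c = e"
proof -
  obtain m n z where z: "pw z m = c" "pw z n = e"
    using comm_append_are_replicate[OF assms(3)] by blast
  have "\<not> m > 1" "\<not> n > 1"
    using assms(1,2) z unfolding primitive_def tpow_def by blast+
  moreover have "m \<noteq> 0" "n \<noteq> 0"
    using z primitive_nonempty[OF assms(1)] primitive_nonempty[OF assms(2)] by auto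
  ultimately have "m = 1" "n = 1" by auto
  then show ?thesis using z by simp
qed

lemma primitive_rotate:
  assumes "primitive (x @ y)"
  shows "primitive (y @ x)"
proof (cases "x = []")
  case True
  then show ?thesis using assms by simp
next
  case False
  show ?thesis
    unfolding primitive_def
  proof
    assume "\<exists>s n. n > 1 \<and> y @ x = tpow s n"
    then obtain s n where n: "n > 1" "pw s n = y @ x"
      by (auto simp: tpow_def)
    obtain a b p q where pq: "s = p @ q" "y = pw s a @ p" "x = q @ pw s b" "n = Suc (a + b)"
      using pw_cut[OF n(2) False] by blast
    have "x @ y = q @ pw (p @ q) (b + a) @ p"
      using pq by (simp add: pw_add)
    also have "\<dots> = pw (q @ p) n"
      using pq(4) by (simp add: pw_rotate add.commute)
    finally show False
      using assms n(1) unfolding primitive_def tpow_def by blast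
  qed
qed

lemma prefix_length_eq: "prefix a w \<Longrightarrow> prefix b w \<Longrightarrow> length a = length b \<Longrightarrow> a = b"
  by (auto simp: prefix_def append_eq_append_conv)

text \<open>A weak form of the Fine-Wilf periodicity theorem: the prefix \<open>z\<close> of length
  \<open>length c + length e\<close> is \<open>c @ e\<close> when read with the first period and
  \<open>e @ c\<close> when read with the second.\<close>

lemma powers_overlap_commute:
  assumes pre: "prefix (pw e j) (pw c m)" and len: "length c + length e \<le> j * length e" "j > 0"
  shows "c @ e = e @ c"
proof -
  define z where "z = take (length c + length e) (pw e j)"
  obtain i where i: "j = Suc i" using len(2) by (cases j) auto
  have lz: "length z = length c + length e"
    using len by (simp add: z_def length_pw)
  have zc: "prefix z (pw c m)"
    using pre take_is_prefix prefix_order.trans unfolding z_def by blast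
  have ze: "prefix z (pw e j)"
    unfolding z_def by (rule take_is_prefix)
  have e: "prefix e (pw c m)"
    using prefix_order.trans[OF _ pre, of e] i by simp
  show ?thesis
  proof (cases "e = []")
    case False
    have "m \<noteq> 0"
      using e False by (cases m) auto
    then obtain l where l: "m = Suc l" by (cases m) auto
    have pl: "prefix (pw c l) (pw c m)"
      using pw_Suc_right[of l c] l by (metis prefix_def)
    have pi: "prefix (pw e i) (pw e j)"
      using pw_Suc_right[of i e] i by (metis prefix_def)
    have c: "prefix c (pw c m)" using l by simp
    have "prefix c z"
      by (rule prefix_length_prefix[OF c zc]) (simp add: lz)
    then obtain z1 where z1: "z = c @ z1" by (auto elim: prefixE)
    have "prefix z1 (pw c l)" using zc[unfolded z1 l] by simp
    then have "prefix z1 (pw c m)" using pl by (rule prefix_order.trans)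
    then have "z1 = e"
      using e lz z1 by (intro prefix_length_eq[of z1 "pw c m" e]) simp_all
    have "prefix e z"
      by (rule prefix_length_prefix[OF _ ze]) (simp_all add: lz i)
    then obtain z2 where z2: "z = e @ z2" by (auto elim: prefixE)
    have "prefix z2 (pw e i)" using ze[unfolded z2 i] by simp
    then have "prefix z2 (pw c m)"
      using prefix_order.trans[OF pi pre] by (rule prefix_order.trans)
    then have "z2 = c"
      using c lz z2 by (intro prefix_length_eq[of z2 "pw c m" c]) simp_all
    then show ?thesis using z1 z2 \<open>z1 = e\<close> by simp
  qed simp
qed

text \<open>
  The overlap has length at least \<open>length d + length e\<close>, so the period rotated to the start of
  the overlap commutes with \<open>e\<close>.
\<close>

lemma powers_synchronize:
  assumes pd: "primitive d" and pe: "primitive e"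
    and conj: "conjugate d e \<Longrightarrow> d = e"
    and eq: "pw d m = y @ pw e j @ t"
    and len: "length d + length e \<le> j * length e"
  shows "d = e \<and> (\<exists>b. t = pw d b)"
proof -
  have ne: "d \<noteq> []" "e \<noteq> []" using pd pe primitive_nonempty by auto
  have j: "j > 0" using len ne by (cases j) auto
  have "pw e j @ t \<noteq> []" using j ne by (cases j) auto
  then obtain a b x z where c: "d = x @ z" "z \<noteq> []" "y = pw d a @ x" "pw e j @ t = z @ pw d b"
      "m = Suc (a + b)"
    using pw_cut[OF eq] by blast
  have "prefix (pw e j) (z @ pw d b @ x)"
    using c(4) by (metis append.assoc prefix_def)
  also have "z @ pw d b @ x = z @ x @ pw (z @ x) b"
    by (simp add: c(1) pw_rotate)
  finally have pre: "prefix (pw e j) (pw (z @ x) (Suc b))" by simp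
  have "(z @ x) @ e = e @ (z @ x)"
    by (rule powers_overlap_commute[OF pre _ j]) (use len c(1) in simp)
  then have zx: "z @ x = e"
    using primitive_commute primitive_rotate pd pe c(1) by blast
  then have de: "d = e"
    using conj c(1) unfolding conjugate_def by blast
  \<comment> \<open>The offset \<open>x\<close> must vanish: otherwise \<open>x\<close> and
    \<open>z\<close> are positive powers of one word, and \<open>d\<close> is not primitive.\<close>
  then have "z @ x = x @ z" using zx c(1) by simp
  then obtain k l s where s: "pw s k = z" "pw s l = x"
    using comm_append_are_replicate by blast
  have "pw s (l + k) = d" using s c(1) by (simp add: pw_add)
  then have "\<not> l + k > 1"
    using pd unfolding primitive_def tpow_def by metis
  moreover have "k \<noteq> 0" using s c(2) by auto
  ultimately have "x = []" using s by (cases l) auto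
  then have eq2: "pw d j @ t = pw d (Suc b)" using c de by simp
  have "j \<le> Suc b"
  proof -
    have "j * length d \<le> Suc b * length d"
      using arg_cong[OF eq2, of length] by (simp add: length_pw)
    then show ?thesis using ne by (simp del: mult_Suc)
  qed
  then have "pw d j @ t = pw d j @ pw d (Suc b - j)"
    using eq2 by (simp add: pw_add[symmetric] del: replicate_Suc)
  then show ?thesis using de by auto
qed

section \<open>The cutting game\<close>

text \<open>A variant of the Ehrenfeucht-Fraisse game that cuts words instead of marking positions
  and goes on with either half. Level 0 already identifies words of length at most 1, which lets
  \<open>k\<close> rounds read \<open>k\<close> letters exactly.\<close>

primrec eqv :: "nat \<Rightarrow> 'b list \<Rightarrow> 'b list \<Rightarrow> bool" where
  "eqv 0 u v \<longleftrightarrow> u = v \<or> 2 \<le> length u \<and> 2 \<le> length v"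
| "eqv (Suc k) u v \<longleftrightarrow>
     (\<forall>u1 u2. u = u1 @ u2 \<longrightarrow> (\<exists>v1 v2. v = v1 @ v2 \<and> eqv k u1 v1 \<and> eqv k u2 v2)) \<and>
     (\<forall>v1 v2. v = v1 @ v2 \<longrightarrow> (\<exists>u1 u2. u = u1 @ u2 \<and> eqv k u1 v1 \<and> eqv k u2 v2))"

lemma eqv_refl [simp]: "eqv k u u"
  by (induction k arbitrary: u) auto

lemma eqv_sym: "eqv k u v \<Longrightarrow> eqv k v u"
proof (induction k arbitrary: u v)
  case (Suc k)
  show ?case
    unfolding eqv.simps
  proof (intro conjI allI impI)
    fix v1 v2 assume "v = v1 @ v2"
    then obtain u1 u2 where "u = u1 @ u2" "eqv k u1 v1" "eqv k u2 v2"
      using Suc.prems unfolding eqv.simps by blast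
    then show "\<exists>u1 u2. u = u1 @ u2 \<and> eqv k v1 u1 \<and> eqv k v2 u2"
      using Suc.IH by blast
  next
    fix u1 u2 assume "u = u1 @ u2"
    then obtain v1 v2 where "v = v1 @ v2" "eqv k u1 v1" "eqv k u2 v2"
      using Suc.prems unfolding eqv.simps by blast
    then show "\<exists>v1 v2. v = v1 @ v2 \<and> eqv k v1 u1 \<and> eqv k v2 u2"
      using Suc.IH by blast
  qed
qed auto

lemma eqv_SucI:
  assumes "\<And>u1 u2. u = u1 @ u2 \<Longrightarrow> \<exists>v1 v2. v = v1 @ v2 \<and> eqv k u1 v1 \<and> eqv k u2 v2"
    and "\<And>v1 v2. v = v1 @ v2 \<Longrightarrow> \<exists>u1 u2. u = u1 @ u2 \<and> eqv k v1 u1 \<and> eqv k v2 u2"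
  shows "eqv (Suc k) u v"
proof -
  have "\<exists>u1 u2. u = u1 @ u2 \<and> eqv k u1 v1 \<and> eqv k u2 v2" if "v = v1 @ v2" for v1 v2
    using assms(2)[OF that] eqv_sym by blast
  then show ?thesis
    using assms(1) unfolding eqv.simps by simp
qed

lemma eqv_cut:
  assumes "eqv (Suc k) (u1 @ u2) v"
  obtains v1 v2 where "v = v1 @ v2" "eqv k u1 v1" "eqv k u2 v2"
proof -
  have "\<exists>v1 v2. v = v1 @ v2 \<and> eqv k u1 v1 \<and> eqv k u2 v2"
    using assms unfolding eqv.simps by simp
  then show ?thesis using that by blast
qed

lemma eqv_trans: "eqv k u v \<Longrightarrow> eqv k v w \<Longrightarrow> eqv k u w"
proof (induction k arbitrary: u v w)
  case (Suc k)
  have *: "\<exists>w1 w2. w = w1 @ w2 \<and> eqv k u1 w1 \<and> eqv k u2 w2"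
    if uvw: "eqv (Suc k) u v" "eqv (Suc k) v w" "u = u1 @ u2" for u v w u1 u2 :: "'a list"
  proof -
    obtain v1 v2 where v: "v = v1 @ v2" "eqv k u1 v1" "eqv k u2 v2"
      by (rule eqv_cut[OF uvw(1)[unfolded uvw(3)]])
    obtain w1 w2 where w: "w = w1 @ w2" "eqv k v1 w1" "eqv k v2 w2"
      by (rule eqv_cut[OF uvw(2)[unfolded v(1)]])
    show ?thesis
      using w(1) Suc.IH[OF v(2) w(2)] Suc.IH[OF v(3) w(3)] by blast
  qed
  show ?case
    using *[OF Suc.prems] *[OF Suc.prems(2,1)[THEN eqv_sym]] by (rule eqv_SucI)
qed auto

lemma eqv_Nil [simp]: "eqv k [] v \<longleftrightarrow> v = []"
proof (induction k arbitrary: v)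
  case (Suc k)
  have "v = []" if a: "eqv (Suc k) [] v"
  proof -
    have "eqv (Suc k) ([] @ []) v" using a by (simp only: append_Nil)
    then obtain v1 v2 where "v = v1 @ v2" "eqv k [] v1" "eqv k [] v2"
      by (rule eqv_cut)
    then show ?thesis using Suc.IH by simp
  qed
  then show ?case by (auto simp del: eqv.simps)
qed auto

lemma eqv_Nil_right [simp]: "eqv k u [] \<longleftrightarrow> u = []"
  using eqv_Nil eqv_sym by blast

text \<open>A cut with an empty right half wastes a round.\<close>

lemma eqv_Suc: "eqv (Suc k) u v \<Longrightarrow> eqv k u v"
proof -
  assume "eqv (Suc k) u v"
  then have "\<exists>v1 v2. v = v1 @ v2 \<and> eqv k u v1 \<and> eqv k [] v2"
    unfolding eqv.simps by (metis append_Nil2)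
  then show ?thesis by auto
qed

lemma eqv_mono: "eqv l u v \<Longrightarrow> k \<le> l \<Longrightarrow> eqv k u v"
  by (induction l) (use eqv_Suc le_Suc_eq in blast)+

text \<open>Each round splits off one letter, which level 0 identifies.\<close>

lemma eqv_short: "eqv k u v \<Longrightarrow> length u \<le> k \<Longrightarrow> u = v"
proof (induction k arbitrary: u v)
  case (Suc k)
  show ?case
  proof (cases u)
    case Nil
    then show ?thesis using Suc.prems by (metis eqv_Nil)
  next
    case (Cons a u')
    then obtain v1 v2 where v: "v = v1 @ v2" "eqv k [a] v1" "eqv k u' v2"
      using Suc.prems(1) unfolding eqv.simps by (metis append_Cons append_Nil)
    have "eqv 0 [a] v1" using v(2) eqv_mono by blast
    then show ?thesis using v Suc.IH[OF v(3)] Suc.prems(2) Cons by auto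
  qed
qed auto

lemma eqv_suffix:
  assumes "eqv (Suc k) (u @ x) v" "length x \<le> k"
  obtains v' where "v = v' @ x" "eqv k u v'"
proof -
  obtain v1 v2 where "v = v1 @ v2" "eqv k u v1" "eqv k x v2"
    by (rule eqv_cut[OF assms(1)])
  then show ?thesis using that eqv_short[OF _ assms(2)] by blast
qed

lemma eqv_prefix:
  assumes "eqv (Suc k) (x @ u) v" "length x \<le> k"
  obtains v' where "v = x @ v'" "eqv k u v'"
proof -
  obtain v1 v2 where "v = v1 @ v2" "eqv k x v1" "eqv k u v2"
    by (rule eqv_cut[OF assms(1)])
  then show ?thesis using that eqv_short[OF _ assms(2)] by blast
qed

text \<open>A cut of the product lies in one of the factors; the other one stays whole and is still
  equivalent one level lower.\<close>

lemma eqv_append: "eqv k u u' \<Longrightarrow> eqv k v v' \<Longrightarrow> eqv k (u @ v) (u' @ v')"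
proof (induction k arbitrary: u u' v v')
  case 0
  then show ?case by auto
next
  case (Suc k)
  have *: "\<exists>z1 z2. u' @ v' = z1 @ z2 \<and> eqv k w1 z1 \<and> eqv k w2 z2"
    if uv: "eqv (Suc k) u u'" "eqv (Suc k) v v'" "u @ v = w1 @ w2" for u u' v v' w1 w2 :: "'a list"
  proof -
    consider s where "u = w1 @ s" "w2 = s @ v" | s where "w1 = u @ s" "v = s @ w2"
      using uv(3) by (auto simp: append_eq_append_conv2)
    then show ?thesis
    proof cases
      case 1
      obtain z s' where z: "u' = z @ s'" "eqv k w1 z" "eqv k s s'"
        by (rule eqv_cut[OF uv(1)[unfolded 1(1)]])
      have "u' @ v' = z @ (s' @ v')" using z(1) by simp
      moreover have "eqv k w2 (s' @ v')"
        unfolding 1(2) using z(3) eqv_Suc[OF uv(2)] by (rule Suc.IH)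
      ultimately show ?thesis using z(2) by blast
    next
      case 2
      obtain s' z where z: "v' = s' @ z" "eqv k s s'" "eqv k w2 z"
        by (rule eqv_cut[OF uv(2)[unfolded 2(2)]])
      have "u' @ v' = (u' @ s') @ z" using z(1) by simp
      moreover have "eqv k w1 (u' @ s')"
        unfolding 2(1) using eqv_Suc[OF uv(1)] z(2) by (rule Suc.IH)
      ultimately show ?thesis using z(3) by blast
    qed
  qed
  show ?case
    using *[OF Suc.prems] *[OF Suc.prems[THEN eqv_sym]] by (rule eqv_SucI)
qed

lemma eqv_map: "eqv k u v \<Longrightarrow> eqv k (map g u) (map g v)"
proof (induction k arbitrary: u v)
  case (Suc k)
  have *: "\<exists>v1 v2. map g v = v1 @ v2 \<and> eqv k u1 v1 \<and> eqv k u2 v2"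
    if uv: "eqv (Suc k) u v" "map g u = u1 @ u2" for u v u1 u2
  proof -
    obtain w1 w2 where w: "u = w1 @ w2" "u1 = map g w1" "u2 = map g w2"
      using uv(2) by (auto simp: map_eq_append_conv)
    obtain v1 v2 where v: "v = v1 @ v2" "eqv k w1 v1" "eqv k w2 v2"
      by (rule eqv_cut[OF uv(1)[unfolded w(1)]])
    have "map g v = map g v1 @ map g v2" using v(1) by simp
    then show ?thesis
      unfolding w(2,3) using Suc.IH[OF v(2)] Suc.IH[OF v(3)] by blast
  qed
  show ?case
    using *[OF Suc.prems] *[OF Suc.prems[THEN eqv_sym]] by (rule eqv_SucI)
qed auto

lemma pw_cut_pos:
  assumes "pw w n = u @ v" "n > 0"
  shows "\<exists>a b x y. w = x @ y \<and> u = pw w a @ x \<and> v = y @ pw w b \<and> n = Suc (a + b)"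
proof (cases "v = []")
  case True
  obtain a where a: "n = Suc a" using assms(2) by (cases n) auto
  have "u = pw w a @ w"
    using assms(1) True unfolding a pw_Suc_right by simp
  then show ?thesis
    using a True by (metis add_0_right append_Nil append_Nil2 concat.simps(1) replicate_0)
qed (use pw_cut[OF assms(1)] in blast)

text \<open>The source of aperiodicity; \<open>T\<close> is uniform in \<open>w\<close>. After any
  cut one side still has a long run, and there the induction hypothesis adds or removes a
  copy.\<close>

lemma eqv_pw: "\<exists>T. \<forall>n\<ge>T. \<forall>w. eqv k (pw w n) (pw w (Suc n))"
proof (induction k)
  case 0
  have "eqv 0 (pw w n) (pw w (Suc n))" if n: "n \<ge> 2" for n and w :: "'a list"
  proof (cases "w = []")
    case False
    then have "1 \<le> length w" by (cases w) auto
    then have "n * 1 \<le> n * length w" by (intro mult_le_mono) auto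
    then have "2 \<le> length (pw w n)" using n unfolding length_pw by linarith
    then show ?thesis by simp
  qed simp
  then show ?case by blast
next
  case (Suc k)
  from Suc.IH obtain T
    where T: "\<forall>n\<ge>T. \<forall>w :: 'a list. eqv k (pw w n) (pw w (Suc n))" ..
  \<comment> \<open>Besides the copy that is cut, \<open>pw w n\<close> keeps at least
    \<open>2 * T\<close> copies, so one side has \<open>T\<close> of them.
    \<open>pw w (Suc n)\<close> keeps \<open>2 * T + 1\<close>, so one side has \<open>T + 1\<close>
    and can lose one.\<close>
  have "eqv (Suc k) (pw w n) (pw w (Suc n))" if n: "n \<ge> 2 * T + 1" for n and w :: "'a list"
  proof -
    have n0: "n > 0" using n by simp
    show ?thesis
      unfolding eqv.simps
    proof (intro conjI allI impI)
      fix u v assume uv: "pw w n = u @ v"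
      obtain a b x y where c: "w = x @ y" "u = pw w a @ x" "v = y @ pw w b" "n = Suc (a + b)"
        using pw_cut_pos[OF uv n0] by blast
      have "a \<ge> T \<or> b \<ge> T" using n c(4) by linarith
      then show "\<exists>v1 v2. pw w (Suc n) = v1 @ v2 \<and> eqv k u v1 \<and> eqv k v v2"
      proof
        assume "a \<ge> T"
        then have "eqv k u (pw w (Suc a) @ x)"
          unfolding c(2) using T eqv_append eqv_refl by blast
        moreover have "pw w (Suc n) = (pw w (Suc a) @ x) @ v"
          using c pw_add[of "Suc a" "Suc b" w] by simp
        ultimately show ?thesis using eqv_refl by blast
      next
        assume "b \<ge> T"
        then have "eqv k v (y @ pw w (Suc b))"
          unfolding c(3) using T eqv_append eqv_refl by blast
        moreover have "pw w (Suc n) = u @ y @ pw w (Suc b)"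
          using c pw_add[of "a" "Suc (Suc b)" w] by simp
        ultimately show ?thesis using eqv_refl by blast
      qed
    next
      fix u v assume uv: "pw w (Suc n) = u @ v"
      obtain a b x y where c: "w = x @ y" "u = pw w a @ x" "v = y @ pw w b" "n = a + b"
        using pw_cut_pos[OF uv zero_less_Suc] by (metis Suc_inject)
      have "a \<ge> Suc T \<or> b \<ge> Suc T" using n c(4) by linarith
      then show "\<exists>v1 v2. pw w n = v1 @ v2 \<and> eqv k v1 u \<and> eqv k v2 v"
      proof
        assume "a \<ge> Suc T"
        then obtain a' where a': "a = Suc a'" "a' \<ge> T" by (cases a) auto
        have "eqv k (pw w a' @ x) u"
          unfolding c(2) a'(1) using T a'(2) eqv_append eqv_refl by blast
        moreover have "pw w n = (pw w a' @ x) @ v"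
          using c a' pw_add[of a' "Suc b" w] by simp
        ultimately show ?thesis using eqv_refl by blast
      next
        assume "b \<ge> Suc T"
        then obtain b' where b': "b = Suc b'" "b' \<ge> T" by (cases b) auto
        have "eqv k (y @ pw w b') v"
          unfolding c(3) b'(1) using T b'(2) eqv_append eqv_refl by blast
        moreover have "pw w n = u @ y @ pw w b'"
          using c b' pw_add[of a "Suc b'" w] by simp
        ultimately show ?thesis using eqv_refl by blast
      qed
    qed
  qed
  then show ?case by blast
qed

text \<open>A class of level \<open>k + 1\<close> is determined by the set of pairs of level
  \<open>k\<close> classes that its cuts produce. Classes are coded by natural numbers because the
  semigroups in the theorem live on sets of naturals.\<close>

lemma eqv_finite_index:
  "\<exists>f :: 'b::finite list \<Rightarrow> nat. finite (range f) \<and> (\<forall>u v. f u = f v \<longleftrightarrow> eqv k u v)"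
proof (induction k)
  case 0
  let ?g = "\<lambda>u :: 'b list. if length u \<le> 1 then Some u else None"
  have "range ?g \<subseteq> insert None (Some ` {u. length u \<le> 1})" by auto
  moreover have "finite {u :: 'b list. length u \<le> 1}"
    using finite_lists_length_le[of "UNIV :: 'b set" 1] by simp
  ultimately have fin: "finite (range ?g)" by (meson finite.insertI finite_imageI finite_subset)
  then obtain e :: "'b list option \<Rightarrow> nat" where e: "inj_on e (range ?g)"
    using finite_imp_inj_to_nat_seg by blast
  have "finite (range (e \<circ> ?g))" unfolding image_comp[symmetric] using fin by (rule finite_imageI)
  moreover have "(e \<circ> ?g) u = (e \<circ> ?g) v \<longleftrightarrow> eqv 0 u v" for u v
  proof -
    have "(e \<circ> ?g) u = (e \<circ> ?g) v \<longleftrightarrow> ?g u = ?g v"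
      unfolding comp_apply by (rule inj_on_eq_iff[OF e rangeI rangeI])
    then show ?thesis by (auto simp: not_le)
  qed
  ultimately show ?case by blast
next
  case (Suc k)
  then obtain f :: "'b list \<Rightarrow> nat" where f: "finite (range f)" "\<forall>u v. f u = f v \<longleftrightarrow> eqv k u v"
    by (elim exE conjE)
  let ?g = "\<lambda>u. {(f u1, f u2) | u1 u2. u = u1 @ u2}"
  have "range ?g \<subseteq> Set.Pow (range f \<times> range f)" by blast
  then have fin: "finite (range ?g)"
    by (rule finite_subset) (simp add: f(1))
  from finite_imp_inj_to_nat_seg[OF fin] obtain e :: "(nat \<times> nat) set \<Rightarrow> nat" and n
    where "e ` range ?g = {i. i < n}" and e: "inj_on e (range ?g)"
    by (elim exE conjE)
  have "finite (range (e \<circ> ?g))" unfolding image_comp[symmetric] using fin by (rule finite_imageI)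
  moreover have "(e \<circ> ?g) u = (e \<circ> ?g) v \<longleftrightarrow> eqv (Suc k) u v" for u v
  proof -
    have "(e \<circ> ?g) u = (e \<circ> ?g) v \<longleftrightarrow> ?g u = ?g v"
      unfolding comp_apply by (rule inj_on_eq_iff[OF e rangeI rangeI])
    also have "\<dots> \<longleftrightarrow> (\<forall>u1 u2. u = u1 @ u2 \<longrightarrow> (f u1, f u2) \<in> ?g v) \<and>
        (\<forall>v1 v2. v = v1 @ v2 \<longrightarrow> (f v1, f v2) \<in> ?g u)"
      by blast
    also have "\<dots> \<longleftrightarrow> eqv (Suc k) u v"
    proof -
      have 1: "(a, b) \<in> ?g w \<longleftrightarrow> (\<exists>w1 w2. w = w1 @ w2 \<and> f w1 = a \<and> f w2 = b)" for a b w
        by blast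
      have 2: "f w1 = f w2 \<longleftrightarrow> f w2 = f w1" for w1 w2 by auto
      show ?thesis
        unfolding 1 eqv.simps f(2)[rule_format, symmetric] by (simp only: 2)
    qed
    finally show ?thesis .
  qed
  ultimately show ?case by blast
qed

section \<open>The quotient by the cutting game\<close>

primrec flat_factor :: "nat \<Rightarrow> 'a factor \<Rightarrow> 'a list" where
  "flat_factor n (Letter a) = [a]"
| "flat_factor n (Pow t q) = pw (concat (map (flat_factor n) t)) n"

lemma eqv_pw_const:
  fixes w :: "'a list"
  assumes T: "\<And>n. n \<ge> T \<Longrightarrow> eqv k (pw w n) (pw w (Suc n))" and "n \<ge> T"
  shows "eqv k (pw w T) (pw w n)"
  using assms(2)
proof (induction n rule: dec_induct)
  case (step n)
  show ?case by (rule eqv_trans[OF step.IH T[OF step.hyps(1)]])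
qed simp

text \<open>The carrier is \<open>range f\<close>, the set of codes of classes. \<open>T_pos\<close>
  is there because \<open>powers\<close> contains only positive powers.\<close>

locale eqv_quotient =
  fixes f :: "'a list \<Rightarrow> nat" and k T :: nat
  assumes f: "f u = f v \<longleftrightarrow> eqv k u v"
    and fin: "finite (range f)"
    and T_pos: "T > 0"
    and T: "n \<ge> T \<Longrightarrow> eqv k (pw w n) (pw (w :: 'a list) (Suc n))"
begin

definition rep :: "nat \<Rightarrow> 'a list" where "rep x = (SOME w. f w = x)"

definition m :: "nat \<Rightarrow> nat \<Rightarrow> nat" where "m x y = f (rep x @ rep y)"

lemma m_f [simp]: "m (f u) (f v) = f (u @ v)"
proof -
  have "f (rep (f w)) = f w" for w unfolding rep_def by (rule someI) simp
  then show ?thesis unfolding m_def f by (intro eqv_append) (simp_all add: f[symmetric])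
qed

lemma finite_semigroup: "finite_semigroup (range f) m"
  unfolding finite_semigroup_def using fin by auto

lemma f_pw: "n \<ge> T \<Longrightarrow> f (pw w n) = f (pw w T)"
  unfolding f using eqv_pw_const[OF T] eqv_sym by blast

lemma mult_pow_f: "mult_pow m (f w) j (f v) = f (v @ pw w j)"
proof (induction j)
  case (Suc j)
  have "mult_pow m (f w) (Suc j) (f v) = m (mult_pow m (f w) j (f v)) (f w)"
    by (simp add: mult_pow_def)
  then show ?case using Suc pw_Suc_right[of j w] by simp
qed (simp add: mult_pow_def)

lemma omega_f:
  assumes "n \<ge> T"
  shows "omega m (f w) = f (pw w n)"
  unfolding omega_def
proof (rule the_equality)
  obtain n' where n': "n = Suc n'" using assms T_pos by (cases n) auto
  have "f (pw w n) = mult_pow m (f w) n' (f w)" using n' by (simp add: mult_pow_f)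
  moreover have "f (pw w (n + n)) = f (pw w n)"
    using f_pw[of n w] f_pw[of "n + n" w] assms by simp
  ultimately show "f (pw w n) \<in> powers m (f w) \<and> m (f (pw w n)) (f (pw w n)) = f (pw w n)"
    unfolding powers_def m_f pw_add by blast
next
  fix e assume e: "e \<in> powers m (f w) \<and> m e e = e"
  then obtain i where "e = mult_pow m (f w) i (f w)" unfolding powers_def by blast
  then have i: "e = f (pw w (Suc i))" by (simp add: mult_pow_f)
  have "f (pw w (Suc i * Suc j)) = e" for j
  proof (induction j)
    case (Suc j)
    have "f (pw w (Suc i * Suc (Suc j))) = f (pw w (Suc i * Suc j) @ pw w (Suc i))"
      by (metis pw_add mult_Suc_right add.commute)
    also have "\<dots> = m e e" using Suc i m_f by metis
    finally show ?case using e by simp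
  qed (simp add: i)
  \<comment> \<open>An idempotent equals its own powers, so its exponent may be raised beyond
    \<open>T\<close>, where all powers of \<open>f w\<close> agree.\<close>
  from this[of T] have "f (pw w (Suc i * Suc T)) = e" .
  then show "e = f (pw w n)"
    using f_pw[of "Suc i * Suc T" w] f_pw[OF assms, of w] by simp
qed

text \<open>Beyond exponent \<open>T\<close> a further factor changes nothing; cancelling
  \<open>f (pw w T)\<close> in the subgroup leaves \<open>x = e\<close>.\<close>

lemma aperiodic: "aperiodic (range f) m"
  unfolding aperiodic_def
proof (intro allI impI)
  fix G e assume a: "G \<subseteq> range f \<and> group \<lparr>carrier = G, mult = m, one = e\<rparr>"
  let ?G = "\<lparr>carrier = G, mult = m, one = e\<rparr>"
  interpret group ?G using a by blast
  have "x = e" if x: "x \<in> G" for x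
  proof -
    obtain w where w: "x = f w" using a x by blast
    have pow: "f (pw w (Suc j)) \<in> G" for j
    proof (induction j)
      case 0
      show ?case using x w by simp
    next
      case (Suc j)
      have "m (f (pw w (Suc j))) x \<in> G" using m_closed[of "f (pw w (Suc j))" x] Suc x by simp
      then show ?case unfolding w m_f using pw_Suc_right[of "Suc j" w] by (simp only:)
    qed
    obtain j where j: "T = Suc j" using T_pos by (cases T) auto
    have "m (f (pw w T)) x = f (pw w (Suc T))"
      unfolding w m_f pw_Suc_right ..
    also have "\<dots> = f (pw w T)" by (rule f_pw) simp
    finally have eq: "m (f (pw w T)) x = f (pw w T)" .
    have "f (pw w T) \<in> G" using pow j by simp
    then show ?thesis
      using l_cancel_one[of "f (pw w T)" x] x eq by simp
  qed
  moreover have "e \<in> G" using one_closed by simp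
  ultimately show "G = {e}" by blast
qed

lemma list_mult_f: "ws \<noteq> [] \<Longrightarrow> list_mult m (map f ws) = f (concat ws)"
proof -
  have "foldl m (f u) (map f vs) = f (u @ concat vs)" for u vs
    by (induction vs arbitrary: u) auto
  then show "ws \<noteq> [] \<Longrightarrow> ?thesis" by (cases ws) (auto simp: list_mult_def)
qed

lemma value_factor_f:
  assumes "n \<ge> T"
  shows "wf_factor x \<Longrightarrow> omega_factor x \<Longrightarrow> value_factor m (\<lambda>a. f [a]) x = f (flat_factor n x)"
proof (induction x)
  case (Pow t q)
  have "map (value_factor m (\<lambda>a. f [a])) t = map f (map (flat_factor n) t)"
    using Pow by (auto simp: list_all_iff)
  then have "list_mult m (map (value_factor m (\<lambda>a. f [a])) t) = f (concat (map (flat_factor n) t))"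
    using Pow.prems list_mult_f[of "map (flat_factor n) t"] by (simp del: map_map map_eq_conv)
  then show ?case
    using Pow.prems omega_f[OF assms] by (simp add: omega_pow_def mult_pow_def)
qed simp

lemma value_term_f:
  assumes "n \<ge> T" "omega_term t"
  shows "value_term m (\<lambda>a. f [a]) t = f (concat (map (flat_factor n) t))"
proof -
  have "map (value_factor m (\<lambda>a. f [a])) t = map f (map (flat_factor n) t)"
    using assms value_factor_f by (auto simp: omega_term_def wf_kterm_def)
  then show ?thesis
    using assms list_mult_f[of "map (flat_factor n) t"]
    by (simp add: value_term_def omega_term_def del: map_map map_eq_conv)
qed

end

lemma satisfies_imp_eqv:
  fixes \<alpha> \<beta> :: "'a::finite kterm"
  assumes "omega_term \<alpha>" "omega_term \<beta>"
    and sat: "\<And>(S :: nat set) m. finite_semigroup S m \<Longrightarrow> aperiodic S m \<Longrightarrow> satisfies S m \<alpha> \<beta>"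
  shows "\<exists>n0. \<forall>n\<ge>n0. eqv k (concat (map (flat_factor n) \<alpha>)) (concat (map (flat_factor n) \<beta>))"
proof -
  obtain f :: "'a list \<Rightarrow> nat" where f: "finite (range f)" "\<forall>u v. f u = f v \<longleftrightarrow> eqv k u v"
    using eqv_finite_index[of k, where 'b = 'a] by (elim exE conjE)
  from eqv_pw[of k, where 'a = 'a] obtain T
    where T: "\<forall>n\<ge>T. \<forall>w :: 'a list. eqv k (pw w n) (pw w (Suc n))" ..
  \<comment> \<open>The threshold is moved to \<open>Suc T\<close> to make it positive.\<close>
  have T': "eqv k (pw w n) (pw w (Suc n))" if "n \<ge> Suc T" for n and w :: "'a list"
    using T that Suc_leD by blast
  interpret eqv_quotient f k "Suc T"
    by (rule eqv_quotient.intro[OF f(2)[rule_format] f(1) zero_less_Suc T'])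
  have "eqv k (concat (map (flat_factor n) \<alpha>)) (concat (map (flat_factor n) \<beta>))" if "n \<ge> Suc T" for n
  proof -
    have "satisfies (range f) m \<alpha> \<beta>" by (rule sat[OF finite_semigroup aperiodic])
    moreover have "range (\<lambda>a. f [a]) \<subseteq> range f" by auto
    ultimately have "value_term m (\<lambda>a. f [a]) \<alpha> = value_term m (\<lambda>a. f [a]) \<beta>"
      unfolding satisfies_def by simp
    then show ?thesis
      using value_term_f[OF that assms(1)] value_term_f[OF that assms(2)]
      by (simp only: f)
  qed
  then show ?thesis by blast
qed

section \<open>Recognizing expanded powers\<close>

lemma eqv_suffixD:
  assumes "eqv (Suc k) u v" "length x \<le> k" "suffix x u"
  shows "suffix x v"
proof -
  obtain u' where u': "u = u' @ x" using assms(3) by (auto elim: suffixE)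
  show ?thesis
    by (rule eqv_suffix[OF assms(1)[unfolded u'] assms(2)]) (simp add: suffix_def prefix_def)
qed

lemma eqv_prefixD:
  assumes "eqv (Suc k) u v" "length x \<le> k" "prefix x u"
  shows "prefix x v"
proof -
  obtain u' where u': "u = x @ u'" using assms(3) by (auto elim: prefixE)
  show ?thesis
    by (rule eqv_prefix[OF assms(1)[unfolded u'] assms(2)]) (simp add: suffix_def prefix_def)
qed

lemma maximal_power_prefix:
  assumes "d \<noteq> []"
  obtains k v where "w = pw d k @ v" "\<not> prefix d v"
proof -
  have "\<exists>k v. w = pw d k @ v \<and> \<not> prefix d v"
  proof (induction w rule: length_induct)
    case (1 w)
    show ?case
    proof (cases "prefix d w")
      case True
      then obtain w' where w': "w = d @ w'" by (auto elim: prefixE)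
      then have "length w' < length w" using assms by simp
      then obtain k v where "w' = pw d k @ v" "\<not> prefix d v" using 1 by blast
      then have "w = pw d (Suc k) @ v" using w' by simp
      then show ?thesis using \<open>\<not> prefix d v\<close> by blast
    next
      case False
      then have "w = pw d 0 @ w \<and> \<not> prefix d w" by simp
      then show ?thesis by blast
    qed
  qed
  then show ?thesis using that by blast
qed

text \<open>
  Letters satisfying \<open>P\<close> stand for powers of their root \<open>r p\<close>.  \<open>B\<close> bounds the gaps between such
  letters, a run of \<open>N\<close> roots suffices to recognize a power, and \<open>n\<close> is the exponent to which powers
  are expanded.
\<close>

locale blocks =
  fixes P :: "'a factor \<Rightarrow> bool" and r :: "'a factor \<Rightarrow> 'a kterm"
    and D :: "'a factor set" and L B N n :: nat
  assumes D_P: "p \<in> D \<Longrightarrow> P p"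
    and root_primitive: "p \<in> D \<Longrightarrow> primitive (r p)"
    and root_length: "p \<in> D \<Longrightarrow> length (r p) \<le> L"
    and root_conjugate: "p \<in> D \<Longrightarrow> q \<in> D \<Longrightarrow> conjugate (r p) (r q) \<Longrightarrow> p = q"
    and N_large: "N \<ge> B + 2 * (L + 1) * (L + 1)"
    and n_large: "n \<ge> (N + 2) * (L + 1)"
begin

definition unblock :: "'a kterm \<Rightarrow> 'a kterm" where
  "unblock V = concat (map (\<lambda>x. if P x then pw (r x) n else [x]) V)"

definition block_free :: "'a kterm \<Rightarrow> bool" where
  "block_free g \<longleftrightarrow> (\<forall>x\<in>set g. \<not> P x)"

text \<open>(cf.3) and (cf.4) without indices: quantifying over the surrounding words makes the
  property pass to factors, hence to both halves of a cut.\<close>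

definition admissible :: "'a kterm \<Rightarrow> bool" where
  "admissible V \<longleftrightarrow>
     (\<forall>x\<in>set V. P x \<longrightarrow> x \<in> D) \<and>
     (\<forall>X p g Y. V = X @ p # g @ Y \<longrightarrow> P p \<longrightarrow> block_free g \<longrightarrow> \<not> prefix (r p) g) \<and>
     (\<forall>X p g q Y l. V = X @ p # g @ q # Y \<longrightarrow> P p \<longrightarrow> P q \<longrightarrow> block_free g \<longrightarrow>
        \<not> prefix (r p) (g @ pw (r q) l)) \<and>
     (\<forall>X g p Y. V = X @ g @ p # Y \<longrightarrow> P p \<longrightarrow> block_free g \<longrightarrow> \<not> suffix (r p) g) \<and>
     (\<forall>X g Y. V = X @ g @ Y \<longrightarrow> block_free g \<longrightarrow> length g \<le> B)"

lemma admissible_D: "admissible V \<Longrightarrow> x \<in> set V \<Longrightarrow> P x \<Longrightarrow> x \<in> D"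
  by (simp add: admissible_def)

lemma admissible_after:
  assumes "admissible V" "V = X @ p # g @ Y" "P p" "block_free g"
  shows "\<not> prefix (r p) g"
proof -
  have *: "\<forall>X p g Y. V = X @ p # g @ Y \<longrightarrow> P p \<longrightarrow> block_free g \<longrightarrow> \<not> prefix (r p) g"
    using assms(1) unfolding admissible_def by (elim conjE)
  show ?thesis by (rule *[rule_format, OF assms(2-4)])
qed

lemma admissible_between:
  assumes "admissible V" "V = X @ p # g @ q # Y" "P p" "P q" "block_free g"
  shows "\<not> prefix (r p) (g @ pw (r q) l)"
proof -
  have *: "\<forall>X p g q Y l. V = X @ p # g @ q # Y \<longrightarrow> P p \<longrightarrow> P q \<longrightarrow> block_free g \<longrightarrow>
      \<not> prefix (r p) (g @ pw (r q) l)"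
    using assms(1) unfolding admissible_def by (elim conjE)
  show ?thesis by (rule *[rule_format, OF assms(2-5)])
qed

lemma admissible_before:
  assumes "admissible V" "V = X @ g @ p # Y" "P p" "block_free g"
  shows "\<not> suffix (r p) g"
proof -
  have *: "\<forall>X g p Y. V = X @ g @ p # Y \<longrightarrow> P p \<longrightarrow> block_free g \<longrightarrow> \<not> suffix (r p) g"
    using assms(1) unfolding admissible_def by (elim conjE)
  show ?thesis by (rule *[rule_format, OF assms(2-4)])
qed

lemma admissible_gap:
  assumes "admissible V" "V = X @ g @ Y" "block_free g"
  shows "length g \<le> B"
proof -
  have *: "\<forall>X g Y. V = X @ g @ Y \<longrightarrow> block_free g \<longrightarrow> length g \<le> B"
    using assms(1) unfolding admissible_def by (elim conjE)
  show ?thesis by (rule *[rule_format, OF assms(2,3)])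
qed

lemma admissible_factor:
  assumes "admissible (X @ V @ Y)"
  shows "admissible V"
  unfolding admissible_def
proof (intro conjI allI impI ballI)
  fix x assume "x \<in> set V" "P x"
  then show "x \<in> D" using admissible_D[OF assms] by simp
next
  fix X' p g Y' assume "V = X' @ p # g @ Y'" "P p" "block_free g"
  then show "\<not> prefix (r p) g" by (intro admissible_after[OF assms, of "X @ X'" p g "Y' @ Y"]) simp_all
next
  fix X' p g q Y' l assume "V = X' @ p # g @ q # Y'" "P p" "P q" "block_free g"
  then show "\<not> prefix (r p) (g @ pw (r q) l)"
    by (intro admissible_between[OF assms, of "X @ X'" p g q "Y' @ Y"]) simp_all
next
  fix X' g p Y' assume "V = X' @ g @ p # Y'" "P p" "block_free g"
  then show "\<not> suffix (r p) g" by (intro admissible_before[OF assms, of "X @ X'" g p "Y' @ Y"]) simp_all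
next
  fix X' g Y' assume "V = X' @ g @ Y'" "block_free g"
  then show "length g \<le> B" by (intro admissible_gap[OF assms, of "X @ X'" g "Y' @ Y"]) simp_all
qed

lemma admissible_append: "admissible (X @ Y) \<Longrightarrow> admissible X" "admissible (X @ Y) \<Longrightarrow> admissible Y"
  using admissible_factor[of "[]" X Y] admissible_factor[of X Y "[]"] by auto

lemma unblock_Nil [simp]: "unblock [] = []"
  and unblock_Cons: "unblock (x # V) = (if P x then pw (r x) n else [x]) @ unblock V"
  and unblock_append [simp]: "unblock (V @ W) = unblock V @ unblock W"
  by (simp_all add: unblock_def)

lemma unblock_block_free: "block_free g \<Longrightarrow> unblock g = g"
  by (induction g) (auto simp: block_free_def unblock_Cons)

lemma n_pos: "n \<ge> N + 2" "n > 0"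
proof -
  have "N + 2 \<le> (N + 2) * (L + 1)" by simp
  then show "n \<ge> N + 2" using n_large by (rule order.trans)
  then show "n > 0" by simp
qed

lemma L_le_N: "L < N" "L < n"
proof -
  have "L + 1 \<le> 2 * (L + 1) * (L + 1)" by simp
  then have "L + 1 \<le> N" using N_large by linarith
  then show "L < N" by simp
  then show "L < n" using n_pos by linarith
qed

lemma root_nonempty: "p \<in> D \<Longrightarrow> r p \<noteq> []"
  using root_primitive primitive_nonempty by blast

lemma root_pos: "p \<in> D \<Longrightarrow> 1 \<le> length (r p)"
  using root_nonempty by (metis One_nat_def Suc_leI length_greater_0_conv)

lemma length_root_pw: "p \<in> D \<Longrightarrow> k \<le> length (pw (r p) k)" "p \<in> D \<Longrightarrow> length (pw (r p) k) \<le> k * L"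
  using mult_le_mono2[OF root_pos, of p k] mult_le_mono2[OF root_length, of p k]
  by (simp_all add: length_pw)

lemma unblock_eq_Nil: "admissible V \<Longrightarrow> unblock V = [] \<Longrightarrow> V = []"
proof (cases V)
  case (Cons x W)
  assume V: "admissible V" "unblock V = []"
  then have "P x" using Cons by (auto simp: unblock_Cons split: if_splits)
  then have "x \<in> D" using admissible_D[OF V(1)] Cons by simp
  then have "n \<le> length (pw (r x) n)" by (rule length_root_pw)
  then have False using V(2) Cons \<open>P x\<close> n_pos by (simp add: unblock_Cons del: length_concat)
  then show ?thesis ..
qed

lemma last_block:
  obtains "block_free A" | A' q g where "A = A' @ q # g" "P q" "block_free g"
  using split_list_last_prop[of A P] unfolding block_free_def by blast

lemma first_block:
  obtains "block_free A" | g q A' where "A = g @ q # A'" "P q" "block_free g"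
  using split_list_first_prop[of A P] unfolding block_free_def by blast

lemma unblock_cut:
  "unblock V = v1 @ v2 \<Longrightarrow>
    (\<exists>V1 V2. V = V1 @ V2 \<and> v1 = unblock V1 \<and> v2 = unblock V2) \<or>
    (\<exists>V1 q V2 z z'. V = V1 @ q # V2 \<and> P q \<and> pw (r q) n = z @ z' \<and> z \<noteq> [] \<and> z' \<noteq> [] \<and>
       v1 = unblock V1 @ z \<and> v2 = z' @ unblock V2)"
  (is "_ \<Longrightarrow> ?cut V v1 \<or> ?in V v1")
proof (induction V arbitrary: v1)
  case Nil
  then show ?case by simp
next
  case (Cons x V)
  let ?b = "if P x then pw (r x) n else [x]"
  have eq: "?b @ unblock V = v1 @ v2" using Cons.prems by (simp only: unblock_Cons)
  then consider u where "v1 = ?b @ u" "unblock V = u @ v2"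
    | u where "?b = v1 @ u" "v2 = u @ unblock V" "u \<noteq> []"
    unfolding append_eq_append_conv2 by force
  then show ?case
  proof cases
    case 1
    from Cons.IH[OF 1(2)] show ?thesis
    proof
      assume "?cut V u"
      then obtain V1 V2 where "V = V1 @ V2" "u = unblock V1" "v2 = unblock V2" by blast
      then have "x # V = (x # V1) @ V2" "v1 = unblock (x # V1)" "v2 = unblock V2"
        using 1 by (simp_all add: unblock_Cons)
      then show ?thesis by blast
    next
      assume "?in V u"
      then obtain V1 q V2 z z' where "V = V1 @ q # V2" "P q" "pw (r q) n = z @ z'" "z \<noteq> []" "z' \<noteq> []"
        "u = unblock V1 @ z" "v2 = z' @ unblock V2" by blast
      moreover from this have "x # V = (x # V1) @ q # V2" "v1 = unblock (x # V1) @ z"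
        using 1 by (simp_all add: unblock_Cons)
      ultimately show ?thesis by blast
    qed
  next
    case 2
    show ?thesis
    proof (cases "v1 = []")
      case True
      then have "x # V = [] @ (x # V)" "v1 = unblock []" "v2 = unblock (x # V)"
        using 2 by (simp_all add: unblock_Cons)
      then show ?thesis by blast
    next
      case False
      have "P x" using 2 False by (auto simp: Cons_eq_append_conv split: if_splits)
      then have "x # V = [] @ x # V" "P x" "pw (r x) n = v1 @ u" "v1 = unblock [] @ v1" using 2 by simp_all
      then show ?thesis using 2 False by blast
    qed
  qed
qed

text \<open>The letter \<open>q\<close> is indivisible in \<open>V\<close>; comparing lengths turns
  this into a statement about positions in the expansion.\<close>

lemma cut_position:
  assumes "V1 @ q # V2 = C1 @ C2"
  shows "length (unblock C1) \<le> length (unblock V1) \<or> length (unblock (V1 @ [q])) \<le> length (unblock C1)"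
proof -
  consider E where "V1 = C1 @ E" | E where "C1 = V1 @ E" "q # V2 = E @ C2"
    using assms by (auto simp: append_eq_append_conv2)
  then show ?thesis
  proof cases
    case 2
    then show ?thesis by (cases E) (simp_all add: unblock_Cons)
  qed simp
qed

text \<open>The roots of \<open>q\<close> and the short \<open>t\<close> fit into the run of roots
  of \<open>p\<close>, and \<open>L + 1\<close> roots of \<open>q\<close> are an overlap long enough
  for \<open>powers_synchronize\<close>.\<close>

lemma tail_synchronize:
  assumes p: "p \<in> D" and q: "q \<in> D" and suf: "suffix (pw (r p) N) v"
    and v: "v = w @ pw (r q) (L + 1) @ t" and t: "length t \<le> B + L * L + L"
  shows "p = q \<and> (\<exists>b. t = pw (r p) b)"
proof -
  \<comment> \<open>This is where the size of \<open>N\<close> comes from. In the bound on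
    \<open>t\<close>, \<open>B\<close> pays for a gap and \<open>L * L + L\<close> for at most
    \<open>L\<close> roots and a part of another.\<close>
  have "length (pw (r q) (L + 1) @ t) \<le> (L + 1) * L + (B + L * L + L)"
    using length_root_pw(2)[OF q, of "L + 1"] t by simp
  also have "\<dots> \<le> N" using N_large by (simp add: algebra_simps)
  also have "\<dots> \<le> length (pw (r p) N)" by (rule length_root_pw(1)[OF p])
  finally have "length (pw (r q) (L + 1) @ t) \<le> length (pw (r p) N)" .
  then have "suffix (pw (r q) (L + 1) @ t) (pw (r p) N)"
    by (rule suffix_length_suffix[OF suffixI[OF v] suf])
  then obtain y where y: "pw (r p) N = y @ pw (r q) (L + 1) @ t" by (auto elim: suffixE)
  have "length (r p) \<le> L * length (r q)"
    using root_length[OF p] mult_le_mono2[OF root_pos[OF q], of L] by linarith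
  then have "length (r p) + length (r q) \<le> (L + 1) * length (r q)" by simp
  then have *: "r p = r q \<and> (\<exists>b. t = pw (r p) b)"
    using root_conjugate[OF p q]
    by (intro powers_synchronize[OF root_primitive[OF p] root_primitive[OF q] _ y]) auto
  then have "conjugate (r p) (r q)" unfolding conjugate_def by (metis append_Nil append_Nil2)
  then show ?thesis using root_conjugate[OF p q] * by blast
qed

section \<open>Locating the ends of blocks by bounded tests\<close>

definition Block_End :: "'a factor \<Rightarrow> 'a kterm \<Rightarrow> 'a kterm \<Rightarrow> bool" where
  "Block_End p v1 v2 \<longleftrightarrow> suffix (pw (r p) N) v1 \<and> \<not> prefix (r p) v2"

text \<open>The run of \<open>N\<close> roots is too long for a gap and a few further roots, so it
  overlaps some block substantially, and by synchronization that block is \<open>p\<close>. The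
  admissibility conditions then prevent the run from going on beyond the block.\<close>

lemma Block_End_boundary:
  assumes V: "admissible V" and eq: "unblock V = v1 @ v2" and p: "p \<in> D" and e: "Block_End p v1 v2"
  shows "\<exists>V1 V2. V = V1 @ p # V2 \<and> v1 = unblock (V1 @ [p]) \<and> v2 = unblock V2"
proof -
  have suf: "suffix (pw (r p) N) v1" and npre: "\<not> prefix (r p) v2"
    using e by (auto simp: Block_End_def)
  \<comment> \<open>If only a short \<open>z\<close> follows the boundary, the last block before it
    must be \<open>p\<close>, with the run of roots continuing through \<open>g @ z\<close>.\<close>
  have *: "\<exists>A g b. V1 = A @ p # g \<and> block_free g \<and> g @ z = pw (r p) b"
    if V1: "V = V1 @ V2" and v1: "v1 = unblock V1 @ z" and z: "length z \<le> L * L + L" for V1 V2 z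
  proof -
    have gV1: "admissible V1" using V V1 admissible_append by blast
    show ?thesis
    proof (cases rule: last_block[of V1])
      case 1
      have "length v1 \<le> B + L * L + L"
        using v1 z unblock_block_free[OF 1] admissible_gap[OF gV1, of "[]" V1 "[]"] 1 by simp
      also have "\<dots> < N" using N_large by (simp add: algebra_simps)
      also have "N \<le> length (pw (r p) N)" by (rule length_root_pw(1)[OF p])
      also have "\<dots> \<le> length v1" using suf by (rule suffix_length_le)
      finally show ?thesis by simp
    next
      case (2 A q g)
      have q: "q \<in> D" using admissible_D[OF gV1] 2 by simp
      have "length g \<le> B" using admissible_gap[OF gV1, of "A @ [q]" g "[]"] 2 by simp
      moreover have "n = (n - (L + 1)) + (L + 1)" using L_le_N by simp
      then have "pw (r q) n = pw (r q) (n - (L + 1)) @ pw (r q) (L + 1)"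
        by (metis pw_add)
      then have "v1 = (unblock A @ pw (r q) (n - (L + 1))) @ pw (r q) (L + 1) @ (g @ z)"
        using v1 2 unblock_block_free[OF 2(3)] by (simp add: unblock_Cons)
      ultimately have "p = q \<and> (\<exists>b. g @ z = pw (r p) b)"
        using z by (intro tail_synchronize[OF p q suf]) auto
      then show ?thesis using 2 by blast
    qed
  qed
  from unblock_cut[OF eq] show ?thesis
  proof (elim disjE exE conjE)
    fix V1 V2 assume c: "V = V1 @ V2" "v1 = unblock V1" "v2 = unblock V2"
    obtain A g b where A: "V1 = A @ p # g" "block_free g" "g = pw (r p) b"
      using *[OF c(1), of "[]"] c(2) by auto
    have "\<not> prefix (r p) g"
      using admissible_after[OF V, of A p g V2] A c D_P[OF p] by simp
    then have "g = []" using A(3) by (cases b) simp_all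
    then have "V = A @ p # V2" "v1 = unblock (A @ [p])" using A(1) c(1,2) by simp_all
    then show ?thesis using c(3) by blast
  next
    fix V1 q V2 z z'
    assume c: "V = V1 @ q # V2" "P q" "pw (r q) n = z @ z'" "z \<noteq> []" "z' \<noteq> []"
      "v1 = unblock V1 @ z" "v2 = z' @ unblock V2"
    have q: "q \<in> D" using admissible_D[OF V] c by simp
    obtain a b x y where s: "r q = x @ y" "y \<noteq> []" "z = pw (r q) a @ x" "z' = y @ pw (r q) b"
      using pw_cut[OF c(3,5)] by blast
    have x: "length x \<le> L" using root_length[OF q] s(1) by simp
    show ?thesis
    proof (cases "a \<ge> L + 1")
      \<comment> \<open>Enough of \<open>q\<close> precedes the cut to synchronize with
        \<open>q\<close> itself; the cut then lies between two copies, and \<open>v2\<close> begins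
        with a root.\<close>
      case True
      then have "a = (a - (L + 1)) + (L + 1)" by simp
      then have "pw (r q) a = pw (r q) (a - (L + 1)) @ pw (r q) (L + 1)" by (metis pw_add)
      then have v1: "v1 = (unblock V1 @ pw (r q) (a - (L + 1))) @ pw (r q) (L + 1) @ x"
        using c(6) s(3) by simp
      obtain b' where pq: "p = q" "x = pw (r p) b'"
        using tail_synchronize[OF p q suf v1] x by auto
      have "b' = 0"
        using s(1,2) pq by (cases b') auto
      then have "prefix (r p) v2" using s pq c(7) by simp
      then show ?thesis using npre by simp
    next
      \<comment> \<open>The run stems from an earlier block \<open>p\<close> and reaches through the
        gap into the block \<open>q\<close>, which \<open>admissible_between\<close>
        forbids.\<close>
      case False
      then have "a * L \<le> L * L" by (intro mult_le_mono1) simp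
      then have "length (pw (r q) a) \<le> L * L"
        by (rule order.trans[OF length_root_pw(2)[OF q]])
      then have "length z \<le> L * L + L"
        unfolding s(3) length_append using x by (rule add_mono)
      then obtain A g b where A: "V1 = A @ p # g" "block_free g" "g @ z = pw (r p) b"
        using *[OF c(1) c(6)] by blast
      have "b \<noteq> 0" using A(3) c(4) by (cases b) auto
      then have "prefix (r p) (g @ z)" using A(3) by (cases b) auto
      then have "prefix (r p) (g @ pw (r q) n)" unfolding c(3) by (metis append.assoc prefix_prefix)
      moreover have "V = A @ p # g @ q # V2" using c(1) A(1) by simp
      ultimately show ?thesis
        using admissible_between[OF V _ D_P[OF p] c(2) A(2)] by blast
    qed
  qed
qed

text \<open>Since \<open>L < n\<close>, a root of \<open>p\<close> found after the block would lie
  within the next gap and the expansion of the next block, where (cf.4) excludes it; hence the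
  instance \<open>l = n\<close>.\<close>

lemma boundary_Block_End:
  assumes V: "admissible V" "V = V1 @ p # V2" "P p"
  shows "Block_End p (unblock (V1 @ [p])) (unblock V2)"
proof -
  have p: "p \<in> D" using V admissible_D by simp
  have "n = (n - N) + N" using n_pos by simp
  then have "pw (r p) n = pw (r p) (n - N) @ pw (r p) N" by (metis pw_add)
  then have "suffix (pw (r p) N) (unblock (V1 @ [p]))"
    using V(3) by (auto simp: unblock_Cons suffix_def)
  moreover have "\<not> prefix (r p) (unblock V2)"
  proof (cases rule: first_block[of V2])
    case 1
    then show ?thesis using admissible_after[OF V(1), of V1 p V2 "[]"] V unblock_block_free by simp
  next
    case (2 g q A)
    have q: "q \<in> D" using V(1,2) 2 admissible_D by simp
    have "length (r p) \<le> n" using root_length[OF p] L_le_N by linarith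
    then have l: "length (r p) \<le> length (g @ pw (r q) n)"
      using length_root_pw(1)[OF q, of n] by simp
    have e: "unblock V2 = (g @ pw (r q) n) @ unblock A"
      using 2 unblock_block_free by (simp add: unblock_Cons)
    have "prefix (r p) (g @ pw (r q) n)" if "prefix (r p) (unblock V2)"
      by (rule prefix_length_prefix[OF that _ l]) (simp add: e)
    then show ?thesis
      using admissible_between[OF V(1), of V1 p g q A n] V 2 by auto
  qed
  ultimately show ?thesis unfolding Block_End_def by blast
qed

text \<open>
  A cut strictly inside the expansion of \<open>p\<close> splits a copy \<open>x y\<close> of the root, where \<open>x\<close> crosses no
  end of a block, and following the run to the right leads to the end of this block.  If that end
  is out of reach of a bounded search, the run is long enough to have the right end anyway.
\<close>

definition Inside_Block :: "'a kterm \<Rightarrow> 'a kterm \<Rightarrow> bool" where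
  "Inside_Block v1 v2 \<longleftrightarrow> (\<exists>p\<in>D. \<exists>v0 x y. v1 = v0 @ x \<and> r p = x @ y \<and> x \<noteq> [] \<and>
     (\<forall>x1 x2. x = x1 @ x2 \<longrightarrow> x1 \<noteq> [] \<longrightarrow> (\<forall>q\<in>D. \<not> Block_End q (v0 @ x1) (x2 @ v2))) \<and>
     (prefix (y @ pw (r p) N) v2 \<or>
      (\<exists>b<N. \<exists>v3. v2 = y @ pw (r p) b @ v3 \<and> Block_End p (v1 @ y @ pw (r p) b) v3)))"

lemma not_cut_Inside_Block:
  assumes V: "admissible V" and eq: "unblock V = v1 @ v2"
    and nc: "\<not> (\<exists>V1 V2. V = V1 @ V2 \<and> v1 = unblock V1 \<and> v2 = unblock V2)"
  shows "Inside_Block v1 v2"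
proof -
  obtain V1 p V2 z z' where c: "V = V1 @ p # V2" "P p" "pw (r p) n = z @ z'" "z \<noteq> []" "z' \<noteq> []"
      "v1 = unblock V1 @ z" "v2 = z' @ unblock V2"
    using unblock_cut[OF eq] nc by blast
  have p: "p \<in> D" using V c admissible_D by simp
  have "\<exists>a b x y. r p = x @ y \<and> x \<noteq> [] \<and> z = pw (r p) a @ x \<and> z' = y @ pw (r p) b \<and> n = Suc (a + b)"
  proof -
    obtain a b x y where s: "r p = x @ y" "y \<noteq> []" "z = pw (r p) a @ x" "z' = y @ pw (r p) b"
        "n = Suc (a + b)"
      using pw_cut[OF c(3,5)] by blast
    show ?thesis
    proof (cases "x = []")
      \<comment> \<open>\<open>pw_cut\<close> charges a cut between two copies to the right copy; as
        \<open>Inside_Block\<close> wants \<open>x\<close> nonempty, it is charged to the left one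
        instead.\<close>
      case True
      then obtain a' where a': "a = Suc a'" using s(3) c(4) by (cases a) auto
      have "r p = r p @ []" "r p \<noteq> []" "n = Suc (a' + Suc b)" "z' = [] @ pw (r p) (Suc b)"
        using s a' True by simp_all
      moreover have "z = pw (r p) a' @ r p" using s(3) True a' pw_Suc_right by simp
      ultimately show ?thesis by blast
    qed (use s in blast)
  qed
  then obtain a b x y where s: "r p = x @ y" "x \<noteq> []" "z = pw (r p) a @ x" "z' = y @ pw (r p) b"
      "n = Suc (a + b)" by blast
  let ?v0 = "unblock V1 @ pw (r p) a"
  have "v1 = ?v0 @ x" using c s by simp
  \<comment> \<open>A block end within \<open>x\<close> would be a boundary strictly inside the
    expansion of \<open>p\<close>, contrary to \<open>cut_position\<close>.\<close>
  moreover have "\<not> Block_End q (?v0 @ x1) (x2 @ v2)" if x12: "x = x1 @ x2" "x1 \<noteq> []" and q: "q \<in> D" for x1 x2 q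
  proof
    assume e: "Block_End q (?v0 @ x1) (x2 @ v2)"
    have eq': "unblock V = (?v0 @ x1) @ (x2 @ v2)" using eq c s x12 by simp
    obtain W1 W2 where W: "V = W1 @ q # W2" "?v0 @ x1 = unblock (W1 @ [q])"
      using Block_End_boundary[OF V eq' q e] by blast
    have "length (unblock (W1 @ [q])) \<le> length (unblock V1) \<or>
        length (unblock (V1 @ [p])) \<le> length (unblock (W1 @ [q]))"
      by (rule cut_position[of V1 p V2 "W1 @ [q]" W2]) (use W(1) c(1) in simp)
    moreover have "length (unblock V1) < length (?v0 @ x1)" using x12 by simp
    moreover have "length (?v0 @ x1) \<le> length (unblock V1 @ z)" using s x12 by simp
    moreover have "length (unblock V1 @ z) < length (unblock (V1 @ [p]))"
      using c(2,3,5) by (simp add: unblock_Cons del: length_concat)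
    ultimately show False unfolding W(2)[symmetric] by linarith
  qed
  moreover have "prefix (y @ pw (r p) N) v2 \<or>
      (\<exists>b<N. \<exists>v3. v2 = y @ pw (r p) b @ v3 \<and> Block_End p (v1 @ y @ pw (r p) b) v3)"
  proof (cases "b < N")
    case True
    have "v1 @ y @ pw (r p) b = unblock (V1 @ [p])"
      using c by (simp add: unblock_Cons s(4)[symmetric])
    then have "Block_End p (v1 @ y @ pw (r p) b) (unblock V2)"
      using boundary_Block_End[OF V c(1,2)] by simp
    moreover have "v2 = y @ pw (r p) b @ unblock V2" using c s by simp
    ultimately show ?thesis using True by blast
  next
    case False
    then have "b = N + (b - N)" by simp
    then have "pw (r p) b = pw (r p) N @ pw (r p) (b - N)" by (metis pw_add)
    then have "v2 = (y @ pw (r p) N) @ pw (r p) (b - N) @ unblock V2" using c s by simp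
    then show ?thesis by (metis prefixI)
  qed
  ultimately show ?thesis
    unfolding Inside_Block_def using p s(1,2) by blast
qed

text \<open>Followed to its right end, the run stops at the end of a block \<open>p\<close>. If this
  block is left of the cut, then \<open>x\<close> itself ends at a block end. If it is right of the
  cut, either \<open>x\<close> crosses a block end, or a whole root or another \<open>p\<close>
  stands directly before the block, against (cf.3) or (cf.4).\<close>

lemma cut_not_Inside_Block:
  assumes U: "admissible (U1 @ U2)"
  shows "\<not> Inside_Block (unblock U1) (unblock U2)"
proof
  assume "Inside_Block (unblock U1) (unblock U2)"
  then obtain p v0 x y where p: "p \<in> D" and v0: "unblock U1 = v0 @ x" and xy: "r p = x @ y" "x \<noteq> []"
    and ne: "\<forall>x1 x2. x = x1 @ x2 \<longrightarrow> x1 \<noteq> [] \<longrightarrow> (\<forall>q\<in>D. \<not> Block_End q (v0 @ x1) (x2 @ unblock U2))"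
    and v2: "prefix (y @ pw (r p) N) (unblock U2) \<or>
      (\<exists>b<N. \<exists>v3. unblock U2 = y @ pw (r p) b @ v3 \<and> Block_End p (unblock U1 @ y @ pw (r p) b) v3)"
    unfolding Inside_Block_def by (elim bexE exE conjE)
  note ne = ne[rule_format]
  have "\<exists>m v3. unblock U2 = y @ pw (r p) m @ v3 \<and> Block_End p (unblock U1 @ y @ pw (r p) m) v3"
    using v2
  proof
    assume "prefix (y @ pw (r p) N) (unblock U2)"
    then obtain w where w: "unblock U2 = (y @ pw (r p) N) @ w" by (auto elim: prefixE)
    obtain k v3 where k: "w = pw (r p) k @ v3" "\<not> prefix (r p) v3"
      using maximal_power_prefix[OF root_nonempty[OF p]] by blast
    have "unblock U2 = y @ pw (r p) (N + k) @ v3"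
      using w k(1) pw_add[of N k "r p"] by simp
    moreover have "unblock U1 @ y @ pw (r p) (N + k) = (unblock U1 @ y @ pw (r p) k) @ pw (r p) N"
      using pw_add[of k N "r p"] by (simp add: add.commute)
    then have "Block_End p (unblock U1 @ y @ pw (r p) (N + k)) v3"
      using k(2) unfolding Block_End_def by (metis suffixI)
    ultimately show ?thesis by blast
  qed blast
  then obtain m v3 where m: "unblock U2 = y @ pw (r p) m @ v3" "Block_End p (unblock U1 @ y @ pw (r p) m) v3"
    by blast
  have "unblock (U1 @ U2) = (unblock U1 @ y @ pw (r p) m) @ v3" using m(1) by simp
  from Block_End_boundary[OF U this p m(2)] obtain A C where A: "U1 @ U2 = A @ p # C"
    "unblock U1 @ y @ pw (r p) m = unblock (A @ [p])" "v3 = unblock C" by blast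
  have "U1 @ U2 = (A @ [p]) @ C" using A(1) by simp
  then obtain us where "U1 = (A @ [p]) @ us \<or> U1 @ us = A @ [p] \<and> U2 = us @ C"
    unfolding append_eq_append_conv2 by blast
  then have "(\<exists>E. U1 = (A @ [p]) @ E) \<or> (\<exists>C'. A = U1 @ C' \<and> U2 = C' @ p # C)"
    by (cases us rule: rev_cases) (elim disjE conjE, force+)+
  then consider E where "U1 = (A @ [p]) @ E" | C' where "A = U1 @ C'" "U2 = C' @ p # C"
    by blast
  then show False
  proof cases
    case 1
    have "length (unblock (A @ [p])) \<le> length (unblock U1)" unfolding 1 unblock_append[of "A @ [p]" E] by simp
    then have "length y + length (pw (r p) m) = 0"
      using arg_cong[OF A(2), of length] unfolding length_append by linarith
    then have "y = []" "pw (r p) m = []"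
      by (simp_all only: add_is_0 length_0_conv)
    then have "Block_End p (v0 @ x) ([] @ unblock U2)"
      using m(2) v0 unfolding m(1) by (simp only: append_Nil append_Nil2)
    then show False using ne[of x "[]" p] xy(2) p by simp
  next
    case 2
    have eq: "y @ pw (r p) m = unblock C' @ pw (r p) n"
      using A(2) 2 D_P[OF p] by (simp add: unblock_Cons)
    have ly: "length y < length (r p)" using xy by simp
    \<comment> \<open>As \<open>y\<close> is a proper suffix of the root, all \<open>n\<close>
      copies from the block \<open>p\<close> belong to the run \<open>pw (r p) m\<close>.\<close>
    have "n * length (r p) < Suc m * length (r p)"
      using arg_cong[OF eq, of length] ly by (simp add: length_pw)
    then have "n < Suc m" by (rule mult_less_cancel2[THEN iffD1, THEN conjunct2])
    then have "m = (m - n) + n" by simp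
    then have "pw (r p) m = pw (r p) (m - n) @ pw (r p) n" by (metis pw_add)
    then have C': "unblock C' = y @ pw (r p) (m - n)" using eq by simp
    have D': "P p" "U1 @ U2 = U1 @ C' @ p # C" using D_P[OF p] 2 by simp_all
    show False
    proof (cases rule: last_block[of C'])
      case pf: 1
      have xC: "x @ C' = pw (r p) (m - n) @ r p"
        using C' xy(1) unblock_block_free[OF pf] pw_Suc_right[of "m - n" "r p"] by simp
      show False
      proof (cases rule: last_block[of U1])
        case 1
        have "block_free (U1 @ C')" using 1 pf by (auto simp: block_free_def)
        then have "\<not> suffix (r p) (U1 @ C')"
          using admissible_before[OF U, of "[]" "U1 @ C'" p C] D' by simp
        moreover have "U1 @ C' = (v0 @ pw (r p) (m - n)) @ r p"
          using xC v0 unblock_block_free[OF 1] by simp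
        ultimately show False by (metis suffixI)
      next
        case (2 A' q g)
        have "block_free (g @ C')" using 2 pf by (auto simp: block_free_def)
        then have ns: "\<not> suffix (r p) (g @ C')"
          using admissible_before[OF U, of "A' @ [q]" "g @ C'" p C] D' 2 by simp
        have q: "q \<in> D" using admissible_D[OF U] 2 by simp
        have "unblock (A' @ [q]) @ g = v0 @ x"
          using v0 2 unblock_block_free[OF 2(3)] by (simp add: unblock_Cons)
        then consider h where "g = h @ x"
          | x1 where "x1 \<noteq> []" "x = x1 @ g" "unblock (A' @ [q]) = v0 @ x1"
          unfolding append_eq_append_conv2 by force
        then show False
        proof cases
          case 1
          then have "g @ C' = (h @ pw (r p) (m - n)) @ r p" using xC by simp
          then show False using ns by (metis suffixI)
        next
          \<comment> \<open>Here \<open>x\<close> reaches back across the end of the block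
            \<open>q\<close>, which the clause on \<open>x1\<close> and \<open>x2\<close> in
            \<open>Inside_Block\<close> excludes.\<close>
          case x1: 2
          have "Block_End q (unblock (A' @ [q])) (unblock (g @ U2))"
            by (rule boundary_Block_End[OF U]) (use 2 in simp_all)
          then have "Block_End q (v0 @ x1) (g @ unblock U2)"
            using x1 unblock_block_free[OF 2(3)] by simp
          then show False using ne[OF x1(2,1) q] by simp
        qed
      qed
    next
      case (2 E q g)
      \<comment> \<open>Then \<open>C'\<close> is followed by \<open>p\<close> and, ending with a long run of roots of \<open>p\<close>, also ends with \<open>p\<close>.\<close>
      have gC: "admissible C'" using U D'(2) admissible_factor by metis
      have q: "q \<in> D" using admissible_D[OF gC] 2 by simp
      \<comment> \<open>This needs \<open>n_large\<close>: a word of length at least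
        \<open>n\<close>, made of \<open>y\<close> and roots of length at most \<open>L\<close>,
        contains more than \<open>N\<close> roots.\<close>
      have "n \<le> length (unblock C')"
        using 2 length_root_pw(1)[OF q, of n] by (simp add: unblock_Cons del: length_concat)
      also have "\<dots> \<le> Suc (m - n) * L"
        using C' ly root_length[OF p] length_root_pw(2)[OF p, of "m - n"] by simp
      finally have "(N + 2) * (L + 1) \<le> Suc (m - n) * (L + 1)" using n_large by simp
      then have "N + 2 \<le> Suc (m - n)" by (rule mult_le_cancel2[THEN iffD1, THEN mp]) simp
      then have "m - n = (m - n - N) + N" by simp
      then have "pw (r p) (m - n) = pw (r p) (m - n - N) @ pw (r p) N" by (metis pw_add)
      then have "unblock C' = (y @ pw (r p) (m - n - N)) @ pw (r p) N" using C' by simp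
      then have "Block_End p (unblock C') []"
        unfolding Block_End_def using root_nonempty[OF p] by (metis suffixI prefix_Nil)
      then obtain V1 V2 where V: "C' = V1 @ p # V2" "[] = unblock V2"
        using Block_End_boundary[OF gC _ p, of "unblock C'" "[]"] by auto
      have "V2 = []"
        using V admissible_append[of "V1 @ [p]" V2] gC unblock_eq_Nil[of V2] by simp
      then have "U1 @ U2 = (U1 @ V1) @ p # [] @ p # C" using D'(2) V(1) by simp
      then show False
        using admissible_between[OF U _ D'(1) D'(1), of "U1 @ V1" "[]" C 1] by (simp add: block_free_def)
    qed
  qed
qed

section \<open>Lifting the game from expansions to terms\<close>

text \<open>\<open>Suc (N * L + L)\<close> rounds carry over \<open>Block_End\<close>, whose test
  words have length at most \<open>N * L + L\<close>; one more round cuts off the bounded word next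
  to the place where it is tested.\<close>

definition depth :: nat where
  "depth = Suc (Suc (N * L + L))"

lemma Block_End_eqv:
  assumes "eqv (Suc (N * L + L)) v1 u1" "eqv (Suc (N * L + L)) v2 u2" "p \<in> D" "Block_End p v1 v2"
  shows "Block_End p u1 u2"
proof -
  have "length (pw (r p) N) \<le> N * L + L" using length_root_pw(2)[OF assms(3), of N] by linarith
  moreover have "length (r p) \<le> N * L + L" using root_length[OF assms(3)] by linarith
  ultimately show ?thesis
    using assms(4) eqv_suffixD[OF assms(1)] eqv_prefixD[OF eqv_sym[OF assms(2)]]
    unfolding Block_End_def by blast
qed

lemma Inside_Block_eqv:
  assumes e1: "eqv depth v1 u1" and e2: "eqv depth v2 u2" and "Inside_Block v1 v2"
  shows "Inside_Block u1 u2"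
proof -
  let ?k = "Suc (N * L + L)"
  obtain p v0 x y where p: "p \<in> D" and v0: "v1 = v0 @ x" and xy: "r p = x @ y" "x \<noteq> []"
    and ne: "\<forall>x1 x2. x = x1 @ x2 \<longrightarrow> x1 \<noteq> [] \<longrightarrow> (\<forall>q\<in>D. \<not> Block_End q (v0 @ x1) (x2 @ v2))"
    and v2: "prefix (y @ pw (r p) N) v2 \<or>
      (\<exists>b<N. \<exists>v3. v2 = y @ pw (r p) b @ v3 \<and> Block_End p (v1 @ y @ pw (r p) b) v3)"
    using assms(3) unfolding Inside_Block_def by (elim bexE exE conjE)
  note ne = ne[rule_format]
  have lx: "length x \<le> L" "length y \<le> L" using xy root_length[OF p] by simp_all
  note f1 = eqv_Suc[OF e1[unfolded depth_def]]
  note f2 = eqv_Suc[OF e2[unfolded depth_def]]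
  obtain u0 where u0: "u1 = u0 @ x" "eqv ?k v0 u0"
    by (rule eqv_suffix[OF e1[unfolded v0 depth_def]]) (use lx in simp)
  have ne': "\<not> Block_End q (u0 @ x1) (x2 @ u2)" if "x = x1 @ x2" "x1 \<noteq> []" "q \<in> D" for x1 x2 q
  proof
    assume "Block_End q (u0 @ x1) (x2 @ u2)"
    moreover have "eqv ?k (u0 @ x1) (v0 @ x1)" by (rule eqv_append[OF eqv_sym[OF u0(2)] eqv_refl])
    moreover have "eqv ?k (x2 @ u2) (x2 @ v2)" by (rule eqv_append[OF eqv_refl eqv_sym[OF f2]])
    ultimately have "Block_End q (v0 @ x1) (x2 @ v2)" using Block_End_eqv that(3) by blast
    then show False using ne[OF that] by blast
  qed
  have "prefix (y @ pw (r p) N) u2 \<or>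
      (\<exists>b<N. \<exists>v3. u2 = y @ pw (r p) b @ v3 \<and> Block_End p (u1 @ y @ pw (r p) b) v3)"
    using v2
  proof (elim disjE exE conjE)
    assume "prefix (y @ pw (r p) N) v2"
    moreover have "length (y @ pw (r p) N) \<le> ?k"
      using lx length_root_pw(2)[OF p, of N] by simp
    ultimately show ?thesis
      using eqv_prefixD[OF e2[unfolded depth_def]] by blast
  next
    fix b v3 assume b: "b < N" "v2 = y @ pw (r p) b @ v3" "Block_End p (v1 @ y @ pw (r p) b) v3"
    have "b * L \<le> N * L" using b(1) by (intro mult_le_mono1) simp
    then have "length (pw (r p) b) \<le> N * L"
      by (rule order.trans[OF length_root_pw(2)[OF p]])
    then have "length (y @ pw (r p) b) \<le> ?k"
      unfolding length_append using lx(2) by linarith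
    moreover have "eqv (Suc ?k) ((y @ pw (r p) b) @ v3) u2"
      using e2 b(2) unfolding depth_def by (simp only: append.assoc)
    ultimately obtain u3 where u3: "u2 = (y @ pw (r p) b) @ u3" "eqv ?k v3 u3"
      using eqv_prefix by blast
    have "eqv ?k (v1 @ y @ pw (r p) b) (u1 @ y @ pw (r p) b)" by (rule eqv_append[OF f1 eqv_refl])
    then have "Block_End p (u1 @ y @ pw (r p) b) u3" using Block_End_eqv[OF _ u3(2) p b(3)] by blast
    then show ?thesis using u3(1) b(1) by (metis append.assoc)
  qed
  then show ?thesis unfolding Inside_Block_def using p u0(1) xy ne' by blast
qed

text \<open>If the reply were not at a boundary, \<open>Inside_Block\<close> would hold for it,
  hence by equivalence for the boundary cut in \<open>U1 @ U2\<close>, which is impossible.\<close>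

lemma unblock_eqv_cut:
  assumes U: "admissible (U1 @ U2)" and V: "admissible V" and k: "k \<ge> depth"
    and eq: "eqv (Suc k) (unblock (U1 @ U2)) (unblock V)"
  shows "\<exists>V1 V2. V = V1 @ V2 \<and> eqv k (unblock U1) (unblock V1) \<and> eqv k (unblock U2) (unblock V2)"
proof -
  obtain v1 v2 where v: "unblock V = v1 @ v2" "eqv k (unblock U1) v1" "eqv k (unblock U2) v2"
    by (rule eqv_cut[OF eq[unfolded unblock_append]])
  have "\<not> Inside_Block v1 v2"
  proof
    assume "Inside_Block v1 v2"
    then have "Inside_Block (unblock U1) (unblock U2)"
      using Inside_Block_eqv eqv_mono[OF eqv_sym[OF v(2)] k] eqv_mono[OF eqv_sym[OF v(3)] k] by blast
    then show False using cut_not_Inside_Block[OF U] by blast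
  qed
  then show ?thesis using not_cut_Inside_Block[OF V v(1)] v(2,3) by blast
qed

text \<open>A round on the terms is simulated by a round on the expansions. The
  \<open>Suc depth\<close> rounds in reserve keep each reply at a boundary and finally tell single
  letters apart.\<close>

lemma eqv_unblock:
  assumes "admissible U" "admissible V" "eqv (k + Suc depth) (unblock U) (unblock V)"
  shows "eqv k U V"
  using assms
proof (induction k arbitrary: U V)
  case 0
  have long: "2 \<le> length V" if U: "admissible U" and V: "admissible V"
    and e: "eqv (Suc depth) (unblock U) (unblock V)" and l: "2 \<le> length U" for U V
  proof -
    obtain a U' where U': "U = [a] @ U'" "U' \<noteq> []"
      using l by (cases U; cases "tl U") auto
    obtain V1 V2 where V': "V = V1 @ V2" "eqv depth (unblock [a]) (unblock V1)" "eqv depth (unblock U') (unblock V2)"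
      using unblock_eqv_cut[OF U[unfolded U'(1)] V order_refl e[unfolded U'(1)]] by blast
    have "unblock [a] \<noteq> []" "unblock U' \<noteq> []"
      using unblock_eq_Nil admissible_append U unfolding U'(1) using U'(2) by blast+
    then have "V1 \<noteq> []" "V2 \<noteq> []" using V'(2,3) by auto
    then show ?thesis using V'(1) by (cases V1; cases V2) auto
  qed
  have e: "eqv (Suc depth) (unblock U) (unblock V)" using 0 by simp
  have letter: "W = [a]" if a: "\<not> P a" and W: "admissible W" "length W < 2"
    and e: "eqv (Suc depth) (unblock [a]) (unblock W)" for a W
  proof -
    have "unblock [a] = unblock W" by (rule eqv_short[OF e]) (use a in \<open>simp add: unblock_Cons\<close>)
    then have W': "unblock W = [a]" using a by (simp add: unblock_Cons)
    then obtain b where b: "W = [b]" using W(2) by (cases W) auto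
    have "\<not> P b"
    proof
      assume "P b"
      then have "n \<le> length (unblock W)"
        using b admissible_D[OF W(1)] length_root_pw(1)[of b n] by (simp add: unblock_Cons del: length_concat)
      then show False using W' n_pos(1) by simp
    qed
    then show ?thesis using W' b by (simp add: unblock_Cons)
  qed
  show ?case
  proof (cases "2 \<le> length U \<or> 2 \<le> length V")
    case True
    then show ?thesis using long[OF 0(1,2) e] long[OF 0(2,1) eqv_sym[OF e]] by auto
  next
    case False
    have "U = V"
    proof (cases U)
      case Nil
      then show ?thesis using e unblock_eq_Nil[OF 0(2)] by auto
    next
      case (Cons a U')
      then have a: "U = [a]" using False by (cases U') auto
      show ?thesis
      proof (cases "P a")
        case False': False
        then show ?thesis using letter[OF False' 0(2)] e a False by simp
      next
        \<comment> \<open>The expansion of \<open>a\<close> is too long to be read in full, but its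
          end identifies the block.\<close>
        case True
        have aD: "a \<in> D" using admissible_D[OF 0(1)] a True by simp
        have "Block_End a (unblock ([] @ [a])) (unblock [])"
          by (rule boundary_Block_End[OF 0(1)]) (use a True in simp_all)
        then have "Block_End a (unblock U) []" using a by simp
        moreover have "eqv (Suc (N * L + L)) (unblock U) (unblock V)"
          by (rule eqv_mono[OF e]) (simp add: depth_def)
        ultimately have "Block_End a (unblock V) []" using Block_End_eqv[OF _ eqv_refl aD] by blast
        then obtain V1 V2 where "V = V1 @ a # V2"
          using Block_End_boundary[OF 0(2) _ aD, of "unblock V" "[]"] by auto
        then show ?thesis using a False by (cases V1; cases V2) auto
      qed
    qed
    then show ?thesis by simp
  qed
next
  case (Suc k)
  have *: "\<exists>V1 V2. V = V1 @ V2 \<and> eqv k U1 V1 \<and> eqv k U2 V2"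
    if U: "admissible U" and V: "admissible V" and e: "eqv (Suc k + Suc depth) (unblock U) (unblock V)"
      and c: "U = U1 @ U2" for U V U1 U2
  proof -
    have e': "eqv (Suc (k + Suc depth)) (unblock (U1 @ U2)) (unblock V)" using e c by (simp only: add_Suc)
    obtain V1 V2 where V': "V = V1 @ V2" "eqv (k + Suc depth) (unblock U1) (unblock V1)"
        "eqv (k + Suc depth) (unblock U2) (unblock V2)"
      using unblock_eqv_cut[OF U[unfolded c] V _ e'] by auto
    then show ?thesis
      using Suc.IH[OF _ _ V'(2)] Suc.IH[OF _ _ V'(3)] U V c admissible_append by blast
  qed
  show ?case
    using *[OF Suc.prems] *[OF Suc.prems(2,1) eqv_sym[OF Suc.prems(3)]] by (rule eqv_SucI)
qed

end

section \<open>Expanding the powers of high rank\<close>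

lemma rank_le_iff: "rank t \<le> j \<longleftrightarrow> (\<forall>x\<in>set t. rank_factor x \<le> j)"
  by (induction t) (auto simp: rank_def)

lemma rank_attained: "rank t > 0 \<Longrightarrow> \<exists>x\<in>set t. rank_factor x = rank t"
  by (induction t) (auto simp: rank_def max_def split: if_splits)

lemma rank_factor_Pow: "rank_factor (Pow t q) = Suc (rank t)"
  by (simp add: rank_def)

text \<open>Interpolates between the plain word of letters (\<open>j = 0\<close>) and the term
  itself (\<open>j\<close> at least its rank).\<close>

primrec expand_factor :: "nat \<Rightarrow> nat \<Rightarrow> 'a factor \<Rightarrow> 'a kterm" where
  "expand_factor n j (Letter a) = [Letter a]"
| "expand_factor n j (Pow t q) =
     (if rank_factor (Pow t q) \<le> j then [Pow t q] else pw (concat (map (expand_factor n j) t)) n)"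

declare expand_factor.simps(2) [simp del]

definition expand :: "nat \<Rightarrow> nat \<Rightarrow> 'a kterm \<Rightarrow> 'a kterm" where
  "expand n j t = concat (map (expand_factor n j) t)"

lemma expand_factor_Pow: "expand_factor n j (Pow t q) = (if Suc (rank t) \<le> j then [Pow t q] else pw (expand n j t) n)"
  by (simp only: expand_factor.simps rank_factor_Pow expand_def)

lemma expand_simps [simp]:
  "expand n j [] = []" "expand n j (x # t) = expand_factor n j x @ expand n j t" "expand n j (s @ t) = expand n j s @ expand n j t"
  by (simp_all add: expand_def)

lemma expand_pw: "expand n j (pw t m) = pw (expand n j t) m"
  by (induction m) auto

lemma set_pw: "set (pw t m) \<subseteq> set t"
  by (induction m) auto

lemma expand_factor_id: "rank_factor x \<le> j \<Longrightarrow> expand_factor n j x = [x]"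
  by (cases x) (auto simp: expand_factor_Pow rank_factor_Pow simp del: rank_factor.simps(2))

lemma expand_id: "rank t \<le> j \<Longrightarrow> expand n j t = t"
  by (induction t) (auto simp: rank_le_iff expand_factor_id)

lemma expand_factor_0: "expand_factor n 0 x = map Letter (flat_factor n x)"
proof (induction x)
  case (Pow t q)
  have "expand n 0 t = map Letter (concat (map (flat_factor n) t))"
    using Pow unfolding expand_def by (induction t) auto
  then show ?case
    by (simp add: expand_factor_Pow map_concat map_replicate del: map_map)
qed simp

lemma expand_0: "expand n 0 t = map Letter (concat (map (flat_factor n) t))"
  by (induction t) (auto simp: expand_factor_0)

lemma expand_expand_factor: "j \<le> j' \<Longrightarrow> expand n j (expand_factor n j' x) = expand_factor n j x"
proof (induction x)
  case (Pow t q)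
  have "expand n j (expand n j' t) = expand n j t"
    using Pow by (induction t) auto
  then show ?case
    using Pow.prems by (simp add: expand_factor_Pow expand_pw)
qed simp

lemma expand_expand: "j \<le> j' \<Longrightarrow> expand n j (expand n j' t) = expand n j t"
  by (induction t) (auto simp: expand_expand_factor)

lemma expand_factor_rank: "y \<in> set (expand_factor n j x) \<Longrightarrow> rank_factor y \<le> j"
proof (induction x)
  case (Pow t q)
  show ?case
  proof (cases "Suc (rank t) \<le> j")
    case True
    then show ?thesis using Pow.prems by (simp add: expand_factor_Pow rank_factor_Pow del: rank_factor.simps(2))
  next
    case False
    then have "y \<in> set (expand n j t)" using Pow.prems set_pw[of n "expand n j t"] by (auto simp: expand_factor_Pow)
    then show ?thesis using Pow.IH by (auto simp: expand_def)
  qed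
qed simp

lemma expand_rank: "rank (expand n j t) \<le> j"
  unfolding rank_le_iff expand_def using expand_factor_rank by auto

lemma expand_factor_omega: "y \<in> set (expand_factor n j x) \<Longrightarrow> omega_factor x \<Longrightarrow> omega_factor y"
proof (induction x)
  case (Pow t q)
  show ?case
  proof (cases "Suc (rank t) \<le> j")
    case True
    then show ?thesis using Pow.prems by (simp add: expand_factor_Pow)
  next
    case False
    then have "y \<in> set (expand n j t)" using Pow.prems set_pw[of n "expand n j t"] by (auto simp: expand_factor_Pow)
    then show ?thesis using Pow by (auto simp: expand_def list_all_iff)
  qed
qed simp

lemma expand_omega:
  assumes "omega_term t" "x \<in> set (expand n j t)"
  shows "omega_factor x"
proof -
  obtain y where y: "y \<in> set t" "x \<in> set (expand_factor n j y)"
    using assms(2) unfolding expand_def by auto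
  then show ?thesis using expand_factor_omega[OF y(2)] assms(1) unfolding omega_term_def by blast
qed

text \<open>Ensures that each expanded base contains a letter of rank \<open>j\<close>, as
  \<open>below_square\<close> requires; exponent 0 would erase it.\<close>

lemma expand_factor_attains:
  "0 < j \<Longrightarrow> j \<le> rank_factor x \<Longrightarrow> \<exists>y\<in>set (expand_factor (Suc n) j x). rank_factor y = j"
proof (induction x)
  case (Pow t q)
  show ?case
  proof (cases "Suc (rank t) \<le> j")
    case True
    then show ?thesis using Pow.prems by (simp add: expand_factor_Pow rank_factor_Pow del: rank_factor.simps(2))
  next
    case False
    then obtain z where z: "z \<in> set t" "rank_factor z = rank t"
      using rank_attained[of t] Pow.prems(1) by auto
    then obtain y where y: "y \<in> set (expand_factor (Suc n) j z)" "rank_factor y = j"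
      using Pow.IH[OF z(1)] False Pow.prems(1) by auto
    then have "y \<in> set (expand (Suc n) j t)" using z by (auto simp: expand_def)
    then show ?thesis using y False by (auto simp: expand_factor_Pow)
  qed
qed simp

section \<open>Windows\<close>

text \<open>The shape of the factors that the separation conditions speak of: a gap with at most one
  block letter at either end.\<close>

definition window :: "('b \<Rightarrow> bool) \<Rightarrow> 'b list \<Rightarrow> bool" where
  "window P W \<longleftrightarrow> (\<forall>A x B. W = A @ x # B \<longrightarrow> A \<noteq> [] \<longrightarrow> B \<noteq> [] \<longrightarrow> \<not> P x)"

text \<open>
  Quantifying over all contexts makes this a precongruence, so that no bookkeeping of windows
  crossing the boundary of two factors is needed.
\<close>

definition below :: "('b \<Rightarrow> bool) \<Rightarrow> 'b list \<Rightarrow> 'b list \<Rightarrow> bool" where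
  "below P X Y \<longleftrightarrow>
     (\<forall>A B W. window P W \<longrightarrow> sublist W (A @ X @ B) \<longrightarrow> sublist W (A @ Y @ B))"

lemma belowD: "below P X Y \<Longrightarrow> window P W \<Longrightarrow> sublist W (A @ X @ B) \<Longrightarrow> sublist W (A @ Y @ B)"
  unfolding below_def by blast

lemma below_refl: "below P X X"
  by (simp add: below_def)

lemma below_trans: "below P X Y \<Longrightarrow> below P Y Z \<Longrightarrow> below P X Z"
  by (simp add: below_def)

lemma below_append:
  assumes "below P X X'" "below P Y Y'"
  shows "below P (X @ Y) (X' @ Y')"
  unfolding below_def
proof (intro allI impI)
  fix A B W assume W: "window P W" "sublist W (A @ (X @ Y) @ B)"
  then have "sublist W (A @ X' @ (Y @ B))"
    using belowD[OF assms(1) W(1), of A "Y @ B"] by simp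
  then show "sublist W (A @ (X' @ Y') @ B)"
    using belowD[OF assms(2) W(1), of "A @ X'" B] by simp
qed

lemma below_concat: "(\<And>x. x \<in> set t \<Longrightarrow> below P (f x) (g x)) \<Longrightarrow>
    below P (concat (map f t)) (concat (map g t))"
  by (induction t) (auto intro: below_refl below_append)

lemma below_pw: "below P X Y \<Longrightarrow> below P (pw X n) (pw Y n)"
  by (induction n) (auto intro: below_refl below_append)

text \<open>If \<open>W\<close> met both \<open>C\<close> and \<open>E\<close>, it would contain all
  of \<open>X\<close>, hence a letter satisfying \<open>P\<close> away from its ends.\<close>

lemma window_split:
  assumes W: "window P W" "sublist W (C @ X @ E)" and X: "x \<in> set X" "P x"
  shows "sublist W (C @ X) \<or> sublist W (X @ E)"
proof -
  obtain p s where eq: "C @ X @ E = p @ W @ s" using W(2) unfolding sublist_def by blast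
  consider p' where "p = C @ p'" "X @ E = p' @ W @ s"
    | c where "C = p @ c" "W @ s = c @ X @ E" "c \<noteq> []"
    using eq unfolding append_eq_append_conv2[of C] by fastforce
  then show ?thesis
  proof cases
    case 1
    then show ?thesis unfolding sublist_def by blast
  next
    case 2
    have "W @ s = (c @ X) @ E" using 2(2) by simp
    then consider e where "W = (c @ X) @ e" "e \<noteq> []" | w where "c @ X = W @ w"
      unfolding append_eq_append_conv2[of W] by fastforce
    then show ?thesis
    proof cases
      case e: 1
      obtain X1 X2 where "X = X1 @ x # X2" using X(1) by (meson split_list)
      then have "W = (c @ X1) @ x # (X2 @ e)" using e by simp
      then have "\<not> P x" using W(1) 2(3) e(2) unfolding window_def by blast
      then show ?thesis using X(2) by simp
    next
      case w: 2
      then have "C @ X = p @ W @ w" using 2(1) by simp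
      then show ?thesis unfolding sublist_def by blast
    qed
  qed
qed

lemma sublist_extend: "sublist W X \<Longrightarrow> sublist W (A @ X @ B)"
  unfolding sublist_def by (metis append.assoc)

text \<open>By \<open>window_split\<close> a window extends beyond a copy of \<open>X\<close> on one
  side only. So doubling a single copy breaks no window, and of three copies the middle one may be
  dropped.\<close>

lemma below_square:
  assumes X: "x \<in> set X" "P x"
  shows "below P (pw X (Suc n)) (X @ X)"
proof (induction n)
  case 0
  show ?case
    unfolding below_def
  proof (intro allI impI)
    fix A B W assume "window P W" "sublist W (A @ pw X (Suc 0) @ B)"
    then have "sublist W (A @ X) \<or> sublist W (X @ B)"
      using window_split[of P W A X B] X by simp
    then show "sublist W (A @ (X @ X) @ B)"
      using sublist_extend[of W "A @ X" "[]" "X @ B"] sublist_extend[of W "X @ B" "A @ X" "[]"] by auto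
  qed
next
  case (Suc n)
  have "below P (X @ X @ X) (X @ X)"
    unfolding below_def
  proof (intro allI impI)
    fix A B W assume "window P W" "sublist W (A @ (X @ X @ X) @ B)"
    then have "sublist W ((A @ X) @ X) \<or> sublist W (X @ (X @ B))"
      using window_split[of P W "A @ X" X "X @ B"] X by simp
    then show "sublist W (A @ (X @ X) @ B)"
      using sublist_extend[of W "A @ X @ X" "[]" "B"] sublist_extend[of W "X @ X @ B" "A" "[]"] by auto
  qed
  moreover have "below P (X @ pw X (Suc n)) (X @ X @ X)"
    using below_append[OF below_refl[of P X] Suc.IH] by simp
  ultimately show ?case using below_trans[of P "X @ pw X (Suc n)"] by simp
qed

lemma expand_factor_below:
  assumes "0 < j"
  shows "below (\<lambda>x. rank_factor x = j) (expand_factor (Suc n) j x) (expand_factor 2 j x)"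
proof (induction x)
  case (Pow t q)
  show ?case
  proof (cases "Suc (rank t) \<le> j")
    case True
    then show ?thesis by (simp add: expand_factor_Pow below_refl)
  next
    case False
    then obtain z where z: "z \<in> set t" "rank_factor z = rank t"
      using rank_attained[of t] assms by auto
    then obtain y where y: "y \<in> set (expand_factor 2 j z)" "rank_factor y = j"
      using expand_factor_attains[of j z 1] assms False by (auto simp: numeral_2_eq_2)
    have y': "y \<in> set (expand 2 j t)" using y z by (auto simp: expand_def)
    have "below (\<lambda>x. rank_factor x = j) (expand (Suc n) j t) (expand 2 j t)"
      unfolding expand_def using Pow by (intro below_concat) auto
    then have "below (\<lambda>x. rank_factor x = j) (pw (expand (Suc n) j t) (Suc n)) (pw (expand 2 j t) (Suc n))"
      by (rule below_pw)
    also have "below (\<lambda>x. rank_factor x = j) (pw (expand 2 j t) (Suc n)) (expand 2 j t @ expand 2 j t)"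
      by (rule below_square[where P = "\<lambda>x. rank_factor x = j", OF y' y(2)])
    finally (below_trans) show ?thesis
      using False by (simp add: expand_factor_Pow numeral_2_eq_2)
  qed
qed (simp add: below_refl)

text \<open>Exponent 2 is the one in (cf.1), so what is known about the canonical form
  \<open>expand 2 j t\<close> reaches every \<open>expand n j t\<close>.\<close>

lemma expand_window:
  assumes "0 < j" "0 < n" "window (\<lambda>x. rank_factor x = j) W" "sublist W (expand n j t)"
  shows "sublist W (expand 2 j t)"
proof -
  obtain m where m: "n = Suc m" using assms(2) by (cases n) auto
  have "below (\<lambda>x. rank_factor x = j) (expand n j t) (expand 2 j t)"
    unfolding expand_def m by (rule below_concat) (rule expand_factor_below[OF assms(1)])
  from belowD[OF this assms(3), of "[]" "[]"] show ?thesis using assms(4) by simp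
qed

section \<open>Canonical forms\<close>

lemma word_append [simp]: "word (s @ t) = word s @ word t"
  by (simp add: word_def)

lemma prefix_term_prefix: "prefix s t \<Longrightarrow> term_prefix s t"
  by (auto simp: term_prefix_def elim!: prefixE)

lemma suffix_term_suffix: "suffix s t \<Longrightarrow> term_suffix s t"
  by (auto simp: term_suffix_def suffix_def)

lemma symb_less_linear: "symb_less x y \<or> x = y \<or> symb_less y x"
  by (cases x; cases y) auto

text \<open>Both are minimal in the same conjugacy class, and the lexicographic order is
  total.\<close>

lemma lyndon_conjugate_eq:
  assumes "lyndon s" "lyndon t" "conjugate s t"
  shows "s = t"
proof -
  have "conjugate t s" using assms(3) unfolding conjugate_def by blast
  then have "\<not> term_less s t" "\<not> term_less t s"
    using assms unfolding lyndon_def by blast+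
  then have "word s = word t"
    using lexord_linear[of "{(x, y). symb_less x y}" "word s" "word t"] symb_less_linear
    unfolding term_less_def by auto
  then show ?thesis by (simp add: word_inject)
qed

fun root :: "'a factor \<Rightarrow> 'a kterm" where
  "root (Letter a) = []"
| "root (Pow t q) = t"

definition separated :: "nat \<Rightarrow> 'a::linorder kterm \<Rightarrow> bool" where
  "separated j V \<longleftrightarrow> (let P = \<lambda>x. rank_factor x = Suc j in
     (\<forall>x\<in>set V. P x \<longrightarrow> lyndon (root x)) \<and>
     (\<forall>X p g Y. V = X @ p # g @ Y \<longrightarrow> P p \<longrightarrow> (\<forall>x\<in>set g. \<not> P x) \<longrightarrow> \<not> prefix (root p) g) \<and>
     (\<forall>X p g q Y l. V = X @ p # g @ q # Y \<longrightarrow> P p \<longrightarrow> P q \<longrightarrow> (\<forall>x\<in>set g. \<not> P x) \<longrightarrow>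
        \<not> prefix (root p) (g @ pw (root q) l)) \<and>
     (\<forall>X g p Y. V = X @ g @ p # Y \<longrightarrow> P p \<longrightarrow> (\<forall>x\<in>set g. \<not> P x) \<longrightarrow> \<not> suffix (root p) g))"

lemma separated_lyndon:
  assumes "separated j V" "x \<in> set V" "rank_factor x = Suc j"
  shows "lyndon (root x)"
proof -
  have "\<forall>x\<in>set V. rank_factor x = Suc j \<longrightarrow> lyndon (root x)"
    using assms(1) unfolding separated_def Let_def by (elim conjE)
  then show ?thesis using assms(2,3) by blast
qed

lemma separated_after:
  assumes "separated j V" "V = X @ p # g @ Y" "rank_factor p = Suc j"
    "\<forall>x\<in>set g. rank_factor x \<noteq> Suc j"
  shows "\<not> prefix (root p) g"
proof -
  have *: "\<forall>X p g Y. V = X @ p # g @ Y \<longrightarrow> rank_factor p = Suc j \<longrightarrow>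
      (\<forall>x\<in>set g. rank_factor x \<noteq> Suc j) \<longrightarrow> \<not> prefix (root p) g"
    using assms(1) unfolding separated_def Let_def by (elim conjE)
  show ?thesis by (rule *[THEN spec, THEN spec, THEN spec, THEN spec, THEN mp, THEN mp, THEN mp,
        OF assms(2-4)])
qed

lemma separated_between:
  assumes "separated j V" "V = X @ p # g @ q # Y" "rank_factor p = Suc j" "rank_factor q = Suc j"
    "\<forall>x\<in>set g. rank_factor x \<noteq> Suc j"
  shows "\<not> prefix (root p) (g @ pw (root q) l)"
proof -
  have *: "\<forall>X p g q Y l. V = X @ p # g @ q # Y \<longrightarrow> rank_factor p = Suc j \<longrightarrow>
      rank_factor q = Suc j \<longrightarrow> (\<forall>x\<in>set g. rank_factor x \<noteq> Suc j) \<longrightarrow>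
      \<not> prefix (root p) (g @ pw (root q) l)"
    using assms(1) unfolding separated_def Let_def by (elim conjE)
  show ?thesis by (rule *[THEN spec, THEN spec, THEN spec, THEN spec, THEN spec, THEN spec,
        THEN mp, THEN mp, THEN mp, THEN mp, OF assms(2-5)])
qed

lemma separated_before:
  assumes "separated j V" "V = X @ g @ p # Y" "rank_factor p = Suc j"
    "\<forall>x\<in>set g. rank_factor x \<noteq> Suc j"
  shows "\<not> suffix (root p) g"
proof -
  have *: "\<forall>X g p Y. V = X @ g @ p # Y \<longrightarrow> rank_factor p = Suc j \<longrightarrow>
      (\<forall>x\<in>set g. rank_factor x \<noteq> Suc j) \<longrightarrow> \<not> suffix (root p) g"
    using assms(1) unfolding separated_def Let_def by (elim conjE)
  show ?thesis by (rule *[THEN spec, THEN spec, THEN spec, THEN spec, THEN mp, THEN mp, THEN mp,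
        OF assms(2-4)])
qed

text \<open>Covers levels above the rank of one of the two terms, whose ranks are not known to agree
  in advance.\<close>

lemma separated_low_rank:
  assumes "rank V \<le> j"
  shows "separated j V"
proof -
  have "\<forall>x\<in>set V. rank_factor x \<noteq> Suc j" using assms by (auto simp: rank_le_iff)
  then show ?thesis unfolding separated_def Let_def by auto
qed

definition factorization_tail :: "(nat \<Rightarrow> 'a kterm) \<Rightarrow> (nat \<Rightarrow> 'a factor) \<Rightarrow> nat \<Rightarrow> nat \<Rightarrow> 'a kterm" where
  "factorization_tail \<gamma> p n a = \<gamma> a @ concat (map (\<lambda>k. p k # \<gamma> k) [Suc a..<Suc n])"

lemma factorization_tail_last: "factorization_tail \<gamma> p n n = \<gamma> n"
  by (simp add: factorization_tail_def)

lemma factorization_tail_less: "a < n \<Longrightarrow> factorization_tail \<gamma> p n a = \<gamma> a @ p (Suc a) # factorization_tail \<gamma> p n (Suc a)"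
  by (simp add: factorization_tail_def upt_conv_Cons[of "Suc a"] del: upt_Suc)

text \<open>The alternative for \<open>X'\<close> says that \<open>\<gamma> (k - 1)\<close> is the
  whole gap before \<open>x\<close>: it is preceded by a block letter or by nothing.\<close>

lemma factorization_tail_locate:
  assumes \<gamma>: "\<And>k x. k \<le> n \<Longrightarrow> x \<in> set (\<gamma> k) \<Longrightarrow> \<not> P x"
    and p: "\<And>k. 0 < k \<Longrightarrow> k \<le> n \<Longrightarrow> P (p k)"
    and x: "P x"
  shows "a \<le> n \<Longrightarrow> factorization_tail \<gamma> p n a = X @ x # Y \<Longrightarrow>
    \<exists>k X'. a < k \<and> k \<le> n \<and> x = p k \<and> Y = factorization_tail \<gamma> p n k \<and> X = X' @ \<gamma> (k - 1) \<and>
      (X' = [] \<and> k = Suc a \<or> X' \<noteq> [] \<and> P (last X'))"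
proof (induction a arbitrary: X rule: inc_induct)
  case base
  then have "x \<in> set (\<gamma> n)" by (simp add: factorization_tail_last)
  then show ?case using \<gamma> x by blast
next
  case (step a)
  have eq: "\<gamma> a @ p (Suc a) # factorization_tail \<gamma> p n (Suc a) = X @ x # Y"
    using step.prems step.hyps by (simp add: factorization_tail_less)
  have nx: "x \<notin> set (\<gamma> a)" using \<gamma>[of a x] x step.hyps by auto
  consider "X = \<gamma> a" "x = p (Suc a)" "Y = factorization_tail \<gamma> p n (Suc a)"
    | X2 where "X = \<gamma> a @ p (Suc a) # X2" "factorization_tail \<gamma> p n (Suc a) = X2 @ x # Y"
  proof -
    from eq[unfolded append_eq_append_conv2] obtain us where
      "\<gamma> a = X @ us \<and> us @ p (Suc a) # factorization_tail \<gamma> p n (Suc a) = x # Y \<or>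
       \<gamma> a @ us = X \<and> p (Suc a) # factorization_tail \<gamma> p n (Suc a) = us @ x # Y" by blast
    then show ?thesis
      using nx that by (cases us) auto
  qed
  then show ?case
  proof cases
    case 1
    then have "a < Suc a \<and> Suc a \<le> n \<and> x = p (Suc a) \<and> Y = factorization_tail \<gamma> p n (Suc a) \<and>
        X = [] @ \<gamma> (Suc a - 1) \<and> ([] = [] \<and> Suc a = Suc a \<or> [] \<noteq> [] \<and> P (last []))"
      using step.hyps by simp
    then show ?thesis by blast
  next
    case 2
    from step.IH[OF 2(2)] obtain k X' where k: "Suc a < k" "k \<le> n" "x = p k" "Y = factorization_tail \<gamma> p n k"
      "X2 = X' @ \<gamma> (k - 1)" "X' = [] \<and> k = Suc (Suc a) \<or> X' \<noteq> [] \<and> P (last X')" by blast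
    have "X = (\<gamma> a @ p (Suc a) # X') @ \<gamma> (k - 1)" using 2(1) k(5) by simp
    moreover have "P (last (\<gamma> a @ p (Suc a) # X'))" using k(6) p[of "Suc a"] step.hyps by auto
    moreover have "a < k" using k(1) by simp
    ultimately show ?thesis using k(2-4) by blast
  qed
qed

text \<open>Block letters are located in the factorization, and a block-free \<open>g\<close> next
  to one is confined to the adjacent \<open>\<gamma>\<close>. Excluding prefixes of parenthesized
  words also excludes prefixes of factor lists; likewise for suffixes.\<close>

lemma canonical_separated:
  assumes "canonical (Suc j) V"
  shows "separated j V"
proof -
  obtain n \<gamma> \<delta> q where fac: "factorization j V n \<gamma> \<delta> q"
    and cf2: "\<forall>k\<in>{1..n}. lyndon (\<delta> k)"
    and cf3: "\<forall>k\<in>{1..n}. \<not> term_suffix (\<delta> k) (\<gamma> (k - 1))"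
    and cf4: "\<forall>k\<in>{1..<n}. \<forall>l. \<not> term_prefix (\<delta> k) (\<gamma> k @ tpow (\<delta> (Suc k)) l)"
    and cf4': "\<not> term_prefix (\<delta> n) (\<gamma> n)"
    using assms unfolding canonical.simps by (elim exE conjE)
  let ?P = "\<lambda>x :: 'a factor. rank_factor x = Suc j"
  let ?p = "\<lambda>k. Pow (\<delta> k) (q k)"
  let ?t = "factorization_tail \<gamma> ?p n"
  have V: "V = ?t 0" using fac unfolding factorization_def factorization_tail_def by simp
  have \<gamma>: "\<not> ?P x" if "k \<le> n" "x \<in> set (\<gamma> k)" for k x
    using fac that unfolding factorization_def rank_le_iff by fastforce
  have p: "?P (?p k)" if "0 < k" "k \<le> n" for k
    using fac that unfolding factorization_def rank_factor_Pow by simp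
  have loc: "\<exists>k X'. 0 < k \<and> k \<le> n \<and> x = ?p k \<and> Y = ?t k \<and> X = X' @ \<gamma> (k - 1) \<and>
      (X' = [] \<and> k = Suc 0 \<or> X' \<noteq> [] \<and> ?P (last X'))" if "V = X @ x # Y" "?P x" for X x Y
    by (rule factorization_tail_locate[where P = ?P and p = ?p and \<gamma> = \<gamma>, OF \<gamma> p that(2)])
      (use that(1) V in simp_all)
  show ?thesis
    unfolding separated_def Let_def
  proof (intro conjI allI impI ballI)
    fix x assume x: "x \<in> set V" "?P x"
    then obtain X Y where "V = X @ x # Y" by (meson split_list)
    then obtain k where "0 < k" "k \<le> n" "x = ?p k" using loc x(2) by blast
    then show "lyndon (root x)" using cf2 by simp
  next
    fix X p' g Y assume a: "V = X @ p' # g @ Y" "?P p'" "\<forall>x\<in>set g. \<not> ?P x"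
    obtain k where k: "0 < k" "k \<le> n" "p' = ?p k" "g @ Y = ?t k" using loc[OF a(1,2)] by blast
    show "\<not> prefix (root p') g"
    proof
      assume "prefix (root p') g"
      then have pre: "prefix (\<delta> k) g" using k(3) by simp
      show False
      proof (cases "k = n")
        case True
        then have "prefix g (\<gamma> n)" using k(4) by (metis factorization_tail_last prefixI)
        then have "prefix (\<delta> n) (\<gamma> n)" using pre True prefix_order.trans by blast
        then show False using cf4' prefix_term_prefix by blast
      next
        case False
        then have kn: "k < n" using k(2) by simp
        have "g @ Y = \<gamma> k @ ?p (Suc k) # ?t (Suc k)" using k(4) factorization_tail_less[OF kn] by simp
        then obtain us where us: "g = \<gamma> k @ us \<and> us @ Y = ?p (Suc k) # ?t (Suc k) \<or>
            g @ us = \<gamma> k \<and> Y = us @ ?p (Suc k) # ?t (Suc k)"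
          unfolding append_eq_append_conv2 by blast
        have "prefix g (\<gamma> k)"
        proof (cases us)
          case (Cons u us')
          have "g \<noteq> \<gamma> k @ us" if "u = ?p (Suc k)" using a(3) that Cons p[of "Suc k"] kn by auto
          moreover have "u = ?p (Suc k)" if "us @ Y = ?p (Suc k) # ?t (Suc k)"
            using that unfolding Cons by simp
          ultimately have "g @ us = \<gamma> k" using us by blast
          then show ?thesis by (rule prefixI[OF sym])
        qed (use us in auto)
        then have "prefix (\<delta> k) (\<gamma> k @ tpow (\<delta> (Suc k)) 0)"
          using pre prefix_order.trans by (simp add: tpow_def)
        moreover have "k \<in> {1..<n}" using k kn by simp
        ultimately show False using cf4 prefix_term_prefix by blast
      qed
    qed
  next
    fix X p' g q' Y l
    assume a: "V = X @ p' # g @ q' # Y" "?P p'" "?P q'" "\<forall>x\<in>set g. \<not> ?P x"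
    obtain k where k: "0 < k" "k \<le> n" "p' = ?p k" "g @ q' # Y = ?t k" using loc[OF a(1,2)] by blast
    have "\<exists>k' X'. k < k' \<and> k' \<le> n \<and> q' = ?p k' \<and> Y = ?t k' \<and> g = X' @ \<gamma> (k' - 1) \<and>
        (X' = [] \<and> k' = Suc k \<or> X' \<noteq> [] \<and> ?P (last X'))"
      by (rule factorization_tail_locate[where P = ?P and p = ?p and \<gamma> = \<gamma>, OF \<gamma> p a(3)])
        (use k in simp_all)
    then obtain k' X' where k': "k < k'" "k' \<le> n" "q' = ?p k'" "g = X' @ \<gamma> (k' - 1)"
      "X' = [] \<and> k' = Suc k \<or> X' \<noteq> [] \<and> ?P (last X')"
      by blast
    have "X' = [] \<and> k' = Suc k" using k'(4,5) a(4) by (cases X' rule: rev_cases) auto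
    then have g: "g = \<gamma> k" "q' = ?p (Suc k)" and "k < n" using k' by simp_all
    then have "k \<in> {1..<n}" using k(1) by simp
    then have "\<not> term_prefix (\<delta> k) (\<gamma> k @ tpow (\<delta> (Suc k)) l)" using cf4 by blast
    then show "\<not> prefix (root p') (g @ pw (root q') l)"
      unfolding g k(3) root.simps using prefix_term_prefix unfolding tpow_def by blast
  next
    fix X g p' Y assume a: "V = X @ g @ p' # Y" "?P p'" "\<forall>x\<in>set g. \<not> ?P x"
    have "V = (X @ g) @ p' # Y" using a(1) by simp
    from loc[OF this a(2)] obtain k X' where k: "0 < k" "k \<le> n" "p' = ?p k"
      "X @ g = X' @ \<gamma> (k - 1)" "X' = [] \<and> k = Suc 0 \<or> X' \<noteq> [] \<and> ?P (last X')" by blast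
    show "\<not> suffix (root p') g"
    proof
      assume "suffix (root p') g"
      then have s: "suffix (\<delta> k) g" using k(3) by simp
      from k(4) obtain us where us: "X = X' @ us \<and> us @ g = \<gamma> (k - 1) \<or>
          X @ us = X' \<and> g = us @ \<gamma> (k - 1)"
        unfolding append_eq_append_conv2 by blast
      have "suffix g (\<gamma> (k - 1))"
      proof (cases us rule: rev_cases)
        case (snoc us' u)
        have "\<not> ?P u" if "g = us @ \<gamma> (k - 1)" using a(3) that snoc by simp
        then have "us @ g = \<gamma> (k - 1)" using us snoc k(5) by auto
        then show ?thesis by (rule suffixI[OF sym])
      qed (use us in auto)
      then have "suffix (\<delta> k) (\<gamma> (k - 1))" using s suffix_order.trans by blast
      moreover have "k \<in> {1..n}" using k by simp
      ultimately show False using cf3 suffix_term_suffix by blast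
    qed
  qed
qed

lemma canonical_rank: "canonical i t \<Longrightarrow> rank t = i"
  by (cases i) auto

text \<open>Expanding the powers of rank \<open>i + 1\<close> with exponent 2 produces precisely the
  term in (cf.1).\<close>

lemma canonical_expand_step:
  assumes "canonical (Suc i) t"
  shows "canonical i (expand 2 i t)"
proof -
  obtain n \<gamma> \<delta> q where fac: "factorization i t n \<gamma> \<delta> q"
    and can: "canonical i (\<gamma> 0 @ concat (map (\<lambda>k. tpow (\<delta> k) 2 @ \<gamma> k) [1..<Suc n]))"
    using assms unfolding canonical.simps by (elim exE conjE)
  have t: "t = \<gamma> 0 @ concat (map (\<lambda>k. Pow (\<delta> k) (q k) # \<gamma> k) [1..<Suc n])"
    and \<gamma>: "k \<le> n \<Longrightarrow> expand 2 i (\<gamma> k) = \<gamma> k"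
    and \<delta>: "1 \<le> k \<Longrightarrow> k \<le> n \<Longrightarrow> rank (\<delta> k) = i" for k
    using fac unfolding factorization_def by (auto intro: expand_id)
  have "expand 2 i (concat (map (\<lambda>k. Pow (\<delta> k) (q k) # \<gamma> k) ks)) =
      concat (map (\<lambda>k. tpow (\<delta> k) 2 @ \<gamma> k) ks)" if "set ks \<subseteq> {1..n}" for ks
    using that
  proof (induction ks)
    case (Cons k ks)
    have "expand_factor 2 i (Pow (\<delta> k) (q k)) = tpow (\<delta> k) 2"
      using \<delta>[of k] Cons.prems by (simp add: expand_factor_Pow expand_id tpow_def)
    then show ?case using Cons \<gamma>[of k] by simp
  qed simp
  moreover have "set [1..<Suc n] \<subseteq> {1..n}" by auto
  ultimately have "expand 2 i (concat (map (\<lambda>k. Pow (\<delta> k) (q k) # \<gamma> k) [1..<Suc n])) =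
      concat (map (\<lambda>k. tpow (\<delta> k) 2 @ \<gamma> k) [1..<Suc n])" by blast
  then have "expand 2 i t =
      \<gamma> 0 @ concat (map (\<lambda>k. tpow (\<delta> k) 2 @ \<gamma> k) [1..<Suc n])"
    unfolding t using \<gamma>[of 0] by (simp del: upt_Suc)
  then show ?thesis using can by simp
qed

lemma canonical_expand: "canonical i t \<Longrightarrow> j \<le> i \<Longrightarrow> canonical j (expand 2 j t)"
proof (induction i arbitrary: t)
  case 0
  then show ?case using canonical_rank[OF 0(1)] by (simp add: expand_id)
next
  case (Suc i)
  show ?case
  proof (cases "j = Suc i")
    case True
    then show ?thesis using Suc.prems canonical_rank[OF Suc.prems(1)] by (simp add: expand_id)
  next
    case False
    then have "j \<le> i" using Suc.prems by simp
    then show ?thesis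
      using Suc.IH[OF canonical_expand_step[OF Suc.prems(1)]] by (simp add: expand_expand)
  qed
qed

lemma canonical_expand_separated:
  assumes "canonical i t"
  shows "separated j (expand 2 (Suc j) t)"
proof (cases "Suc j \<le> i")
  case True
  then show ?thesis using canonical_separated canonical_expand[OF assms] by blast
next
  case False
  then have "rank t \<le> j" using canonical_rank[OF assms] by simp
  then show ?thesis using separated_low_rank by (simp add: expand_id)
qed

lemma window_intro:
  assumes g: "\<forall>x\<in>set g. \<not> P x" and a: "length a \<le> 1" and b: "length b \<le> 1"
  shows "window P (a @ g @ b)"
  unfolding window_def
proof (intro allI impI)
  fix A x B assume eq: "a @ g @ b = A @ x # B" and ne: "A \<noteq> []" "B \<noteq> []"
  obtain y A' where A: "A = y # A'" using ne(1) by (cases A) auto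
  obtain B' z where B: "B = B' @ [z]" using ne(2) by (cases B rule: rev_cases) auto
  have eq': "a @ g @ b = (y # A' @ x # B') @ [z]" using eq A B by simp
  have "x \<in> set g"
  proof (cases b rule: rev_cases)
    case Nil
    then show ?thesis using eq' a by (cases a) auto
  next
    case (snoc b' w)
    then have "a @ g = y # A' @ x # B'" using eq' b by (simp add: append_assoc[symmetric] del: append_assoc)
    then show ?thesis using a by (cases a) auto
  qed
  then show "\<not> P x" using g by blast
qed

lemma unblock_expand:
  "concat (map (\<lambda>x. if rank_factor x = Suc j then pw (root x) n else [x]) (expand n (Suc j) t)) =
    expand n j t"
proof -
  have "concat (map (\<lambda>x. if rank_factor x = Suc j then pw (root x) n else [x]) V) = expand n j V"
    if "rank V \<le> Suc j" for V :: "'a kterm"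
    using that
  proof (induction V)
    case (Cons x V)
    have x: "rank_factor x \<le> Suc j" using Cons.prems by (simp add: rank_le_iff)
    have "(if rank_factor x = Suc j then pw (root x) n else [x]) = expand_factor n j x"
    proof (cases x)
      case (Pow s q)
      then show ?thesis
        using x by (auto simp: expand_factor_Pow rank_factor_Pow expand_id simp del: rank_factor.simps(2))
    qed simp
    moreover have "rank V \<le> Suc j" using Cons.prems by (simp add: rank_le_iff)
    ultimately show ?case using Cons.IH by simp
  qed simp
  from this[OF expand_rank] show ?thesis by (simp add: expand_expand)
qed

lemma eqv_expand_Suc:
  fixes \<alpha> \<beta> :: "'a::linorder kterm"
  assumes omega: "omega_term \<alpha>" "omega_term \<beta>"
    and sep: "separated j (expand 2 (Suc j) \<alpha>)" "separated j (expand 2 (Suc j) \<beta>)"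
    and eqv: "\<And>k. \<exists>n0. \<forall>n\<ge>n0. eqv k (expand n j \<alpha>) (expand n j \<beta>)"
  shows "\<exists>n0. \<forall>n\<ge>n0. eqv k (expand n (Suc j) \<alpha>) (expand n (Suc j) \<beta>)"
proof -
  define P where "P = (\<lambda>x :: 'a factor. rank_factor x = Suc j)"
  define S where "S = set (expand 2 (Suc j) \<alpha>) \<union> set (expand 2 (Suc j) \<beta>)"
  define D where "D = {x \<in> S. P x}"
  \<comment> \<open>Every gap in \<open>expand n (Suc j)\<close> is a window and so occurs in an
    exponent 2 expansion, whose length bounds it.\<close>
  define B where "B = length (expand 2 (Suc j) \<alpha>) + length (expand 2 (Suc j) \<beta>)"
  define L where "L = Max (insert 0 ((\<lambda>x. length (root x)) ` D))"
  define N where "N = B + 2 * (L + 1) * (L + 1)"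
  have finD: "finite D" unfolding D_def S_def by simp
  have lyn: "lyndon (root p)" if "p \<in> D" for p
    using that sep[THEN separated_lyndon] unfolding D_def S_def P_def by blast
  \<comment> \<open>The level is \<open>k + Suc depth\<close>, written out because \<open>n0\<close>
    is needed before the locale can be instantiated with \<open>n\<close>.\<close>
  obtain n0 where n0: "\<And>n. n \<ge> n0 \<Longrightarrow>
      eqv (k + Suc (Suc (Suc (N * L + L)))) (expand n j \<alpha>) (expand n j \<beta>)"
    using eqv by blast
  have "eqv k (expand n (Suc j) \<alpha>) (expand n (Suc j) \<beta>)" if n: "n \<ge> max n0 ((N + 2) * (L + 1))" for n
  proof -
    interpret blocks P root D L B N n
    proof
      fix p assume p: "p \<in> D"
      show "P p" using p by (simp add: D_def)
      show "primitive (root p)" using lyn[OF p] by (simp add: lyndon_def)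
      show "length (root p) \<le> L" unfolding L_def using p finD by (intro Max_ge) auto
      fix q assume q: "q \<in> D" and conj: "conjugate (root p) (root q)"
      have eq: "root p = root q" by (rule lyndon_conjugate_eq[OF lyn[OF p] lyn[OF q] conj])
      \<comment> \<open>Equal roots give equal blocks because both exponents are 0.\<close>
      have "omega_factor p" "omega_factor q"
        using p q expand_omega omega unfolding D_def S_def by blast+
      moreover have "rank_factor p = Suc j" "rank_factor q = Suc j"
        using p q by (simp_all add: D_def P_def)
      ultimately show "p = q" using eq by (cases p; cases q) auto
    next
      show "N \<ge> B + 2 * (L + 1) * (L + 1)" by (simp add: N_def)
      show "n \<ge> (N + 2) * (L + 1)" using n by simp
    qed
    have admissible: "admissible (expand n (Suc j) t)"
      if s: "separated j V" and S: "\<forall>x\<in>set V. P x \<longrightarrow> x \<in> D" and B: "length V \<le> B"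
        and V: "V = expand 2 (Suc j) t" for V t
    proof -
      have win: "\<exists>X Y. V = X @ (a @ g @ b) @ Y"
        if "expand n (Suc j) t = X @ (a @ g @ b) @ Y" "block_free g" "length a \<le> 1" "length b \<le> 1" for X a g b Y
      proof -
        have "window P (a @ g @ b)"
          using that(2-4) unfolding block_free_def by (rule window_intro)
        then have "sublist (a @ g @ b) V"
          using expand_window[of "Suc j" n "a @ g @ b" t] that(1) n_pos(2) unfolding P_def V sublist_def
          by blast
        then show ?thesis unfolding sublist_def by blast
      qed
      show ?thesis
        unfolding admissible_def
      proof (intro conjI allI impI ballI)
        fix x assume x: "x \<in> set (expand n (Suc j) t)" "P x"
        then obtain X Y where "expand n (Suc j) t = X @ ([x] @ [] @ []) @ Y"
          by (metis split_list append_Cons append_Nil)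
        then obtain X' Y' where "V = X' @ ([x] @ [] @ []) @ Y'"
          using win[of X "[x]" "[]" "[]" Y] by (auto simp: block_free_def)
        then show "x \<in> D" using S x(2) by simp
      next
        fix X p g Y assume a: "expand n (Suc j) t = X @ p # g @ Y" "P p" "block_free g"
        obtain X' Y' where "V = X' @ p # g @ Y'"
          using win[of X "[p]" g "[]" Y] a by auto
        then show "\<not> prefix (root p) g"
          using a(2,3) unfolding block_free_def unfolding P_def by (rule separated_after[OF s])
      next
        fix X p g q Y l
        assume a: "expand n (Suc j) t = X @ p # g @ q # Y" "P p" "P q" "block_free g"
        obtain X' Y' where "V = X' @ p # g @ q # Y'"
          using win[of X "[p]" g "[q]" Y] a by auto
        then show "\<not> prefix (root p) (g @ pw (root q) l)"
          using a(2-4) unfolding block_free_def unfolding P_def by (rule separated_between[OF s])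
      next
        fix X g p Y assume a: "expand n (Suc j) t = X @ g @ p # Y" "P p" "block_free g"
        obtain X' Y' where "V = X' @ g @ p # Y'"
          using win[of X "[]" g "[p]" Y] a by auto
        then show "\<not> suffix (root p) g"
          using a(2,3) unfolding block_free_def unfolding P_def by (rule separated_before[OF s])
      next
        fix X g Y assume a: "expand n (Suc j) t = X @ g @ Y" "block_free g"
        obtain X' Y' where "V = X' @ g @ Y'"
          using win[of X "[]" g "[]" Y] a by auto
        then show "length g \<le> B" using B by simp
      qed
    qed
    have "admissible (expand n (Suc j) \<alpha>)"
      by (rule admissible[OF sep(1) _ _ refl]) (auto simp: D_def S_def B_def)
    moreover have "admissible (expand n (Suc j) \<beta>)"
      by (rule admissible[OF sep(2) _ _ refl]) (auto simp: D_def S_def B_def)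
    moreover have "unblock (expand n (Suc j) t) = expand n j t" for t
      unfolding unblock_def unfolding P_def by (rule unblock_expand)
    then have "eqv (k + Suc depth) (unblock (expand n (Suc j) \<alpha>)) (unblock (expand n (Suc j) \<beta>))"
      using n0[of n] n unfolding depth_def by simp
    ultimately show ?thesis by (rule eqv_unblock)
  qed
  then show ?thesis by blast
qed

theorem theorem7p2:
  fixes \<alpha> \<beta> :: "'a::{finite,linorder} kterm"
  assumes "omega_term \<alpha>" and "omega_term \<beta>"
    and "canonical_form \<alpha>" and "canonical_form \<beta>"
    and "\<And>(S :: nat set) m. finite_semigroup S m \<Longrightarrow> aperiodic S m \<Longrightarrow> satisfies S m \<alpha> \<beta>"
  shows "\<alpha> = \<beta>"
proof -
  obtain a b where can: "canonical a \<alpha>" "canonical b \<beta>"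
    using assms(3,4) unfolding canonical_form_def by blast
  have "\<exists>n0. \<forall>n\<ge>n0. eqv k (expand n j \<alpha>) (expand n j \<beta>)" for k j
  proof (induction j arbitrary: k)
    case 0
    show ?case
      unfolding expand_0 using satisfies_imp_eqv[OF assms(1,2,5), of k] eqv_map by blast
  next
    case (Suc j)
    show ?case
      by (rule eqv_expand_Suc[OF assms(1,2) can[THEN canonical_expand_separated] Suc.IH])
  qed
  \<comment> \<open>At level \<open>max a b\<close> neither term is expanded any more, and
    \<open>length \<alpha>\<close> rounds read all of \<open>\<alpha>\<close>.\<close>
  from this[of "length \<alpha>" "max a b"] obtain n
    where "eqv (length \<alpha>) (expand n (max a b) \<alpha>) (expand n (max a b) \<beta>)" by blast
  then have "eqv (length \<alpha>) \<alpha> \<beta>"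
    using can[THEN canonical_rank] by (simp add: expand_id)
  then show "\<alpha> = \<beta>" by (rule eqv_short) simp
qed

end
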